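(* Let $K$ be a finite simplicial complex with a simplexwise filtration $K_\bullet$, given by a total order $\sigma_1,\dots,\sigma_m$ of its simplices, and let $p$ be a prime. If $(\sigma,\tau)$ is an apparent pair of $K_\bullet$, then $(\sigma,\tau)$ is a persistence pair of $K_\bullet$ (for homology with coefficients in $\mathbb F_p$).
   Context: Simplices are nonempty finite sets, $\dim\sigma=|\sigma|-1$, and a simplicial complex is a collection of simplices closed under taking nonempty subsets. $\sigma$ is a facet of $\tau$ (and $\tau$ a cofacet of $\sigma$) if $\sigma\subset\tau$ and $\dim\tau=\dim\sigma+1$; facets and cofacets are taken among the simplices of $K$. Simplexwise filtration: a total order $\sigma_1,\dots,\sigma_m$ of all simplices of $K$ in which every simplex comes after all its proper faces; the filtration is $K_0=\emptyset$, $K_i=\{\sigma_1,\dots,\sigma_i\}$, $i\in I=\{0,\dots,m\}$. A simplex is older than another if it comes earlier in this order, and younger if it comes later. Apparent pair: a pair $(\sigma,\tau)$ of simplices of $K$ such that $\sigma$ is the youngest facet of $\tau$ and $\tau$ is the oldest cofacet of $\sigma$. Persistence pair: simplicial homology with coefficients in $\mathbb F_p$ applied to $K_\bullet$ gives a persistence module $H_*(K_\bullet)$, which decomposes into interval modules; the multiset of these intervals is the persistence barcode. $(\sigma_i,\sigma_j)$ is a persistence pair if $[i,j)$ is an interval of the barcode. *)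

theory Defs
  imports
    "HOL-Number_Theory.Residues"
    "HOL-Library.Multiset"
    "Jordan_Normal_Form.Missing_VectorSpace"
begin

section \<open>Simplicial complexes and simplexwise filtrations\<close>

definition simplicial_cplx :: "'v set set \<Rightarrow> bool" where
  "simplicial_cplx K \<longleftrightarrow>
     (\<forall>\<sigma>\<in>K. finite \<sigma> \<and> \<sigma> \<noteq> {}) \<and>
     (\<forall>\<sigma>\<in>K. \<forall>\<rho>. \<rho> \<noteq> {} \<and> \<rho> \<subseteq> \<sigma> \<longrightarrow> \<rho> \<in> K)"

text \<open>Only applied to nonempty finite sets, so the subtraction never truncates.\<close>

definition sdim :: "'v set \<Rightarrow> nat" where
  "sdim \<sigma> = card \<sigma> - 1"

definition facet :: "'v set set \<Rightarrow> 'v set \<Rightarrow> 'v set \<Rightarrow> bool" where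
  "facet K \<sigma> \<tau> \<longleftrightarrow> \<sigma> \<in> K \<and> \<tau> \<in> K \<and> \<sigma> \<subset> \<tau> \<and> sdim \<tau> = sdim \<sigma> + 1"

text \<open>
  The total order \<open>\<sigma>\<^sub>1, \<dots>, \<sigma>\<^sub>m\<close> is a list \<open>\<sigma>s\<close>; the simplex \<open>\<sigma>\<^sub>i\<close> of the mathematical text is
  \<open>\<sigma>s ! (i - 1)\<close>, and \<open>K\<^sub>i\<close> is \<open>filt \<sigma>s i\<close> for \<open>0 \<le> i \<le> m\<close>.
\<close>

definition simplexwise_filtration :: "'v set set \<Rightarrow> 'v set list \<Rightarrow> bool" where
  "simplexwise_filtration K \<sigma>s \<longleftrightarrow>
     distinct \<sigma>s \<and> set \<sigma>s = K \<and>
     (\<forall>i < length \<sigma>s. \<forall>j < length \<sigma>s. \<sigma>s ! i \<subset> \<sigma>s ! j \<longrightarrow> i < j)"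

definition filt :: "'v set list \<Rightarrow> nat \<Rightarrow> 'v set set" where
  "filt \<sigma>s i = set (take i \<sigma>s)"

definition older :: "'v set list \<Rightarrow> 'v set \<Rightarrow> 'v set \<Rightarrow> bool" where
  "older \<sigma>s \<rho> \<sigma> \<longleftrightarrow> (\<exists>i j. i < j \<and> j < length \<sigma>s \<and> \<rho> = \<sigma>s ! i \<and> \<sigma> = \<sigma>s ! j)"

definition youngest_facet :: "'v set list \<Rightarrow> 'v set \<Rightarrow> 'v set \<Rightarrow> bool" where
  "youngest_facet \<sigma>s \<sigma> \<tau> \<longleftrightarrow>
     facet (set \<sigma>s) \<sigma> \<tau> \<and> (\<forall>\<rho>. facet (set \<sigma>s) \<rho> \<tau> \<and> \<rho> \<noteq> \<sigma> \<longrightarrow> older \<sigma>s \<rho> \<sigma>)"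

definition oldest_cofacet :: "'v set list \<Rightarrow> 'v set \<Rightarrow> 'v set \<Rightarrow> bool" where
  "oldest_cofacet \<sigma>s \<tau> \<sigma> \<longleftrightarrow>
     facet (set \<sigma>s) \<sigma> \<tau> \<and> (\<forall>\<upsilon>. facet (set \<sigma>s) \<sigma> \<upsilon> \<and> \<upsilon> \<noteq> \<tau> \<longrightarrow> older \<sigma>s \<tau> \<upsilon>)"

definition apparent_pair :: "'v set list \<Rightarrow> 'v set \<Rightarrow> 'v set \<Rightarrow> bool" where
  "apparent_pair \<sigma>s \<sigma> \<tau> \<longleftrightarrow> youngest_facet \<sigma>s \<sigma> \<tau> \<and> oldest_cofacet \<sigma>s \<tau> \<sigma>"


section \<open>Persistence modules indexed by \<open>{0..m}\<close> and their barcodes\<close>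

record ('k, 'a) pmod =
  sp :: "nat \<Rightarrow> ('k, 'a) module"
  tr :: "nat \<Rightarrow> nat \<Rightarrow> 'a \<Rightarrow> 'a"

definition persistence_module :: "'k ring \<Rightarrow> nat \<Rightarrow> ('k, 'a) pmod \<Rightarrow> bool" where
  "persistence_module F m M \<longleftrightarrow>
     (\<forall>i j. i \<le> j \<and> j \<le> m \<longrightarrow> linear_map F (sp M i) (sp M j) (tr M i j)) \<and>
     (\<forall>i \<le> m. \<forall>x \<in> carrier (sp M i). tr M i i x = x) \<and>
     (\<forall>i j k. i \<le> j \<and> j \<le> k \<and> k \<le> m \<longrightarrow>
        (\<forall>x \<in> carrier (sp M i). tr M j k (tr M i j x) = tr M i k x))"

definition pmod_iso :: "'k ring \<Rightarrow> nat \<Rightarrow> ('k, 'a) pmod \<Rightarrow> ('k, 'b) pmod \<Rightarrow> bool" where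
  "pmod_iso F m M N \<longleftrightarrow>
     (\<exists>\<phi>. (\<forall>i \<le> m. linear_map F (sp M i) (sp N i) (\<phi> i) \<and>
                   bij_betw (\<phi> i) (carrier (sp M i)) (carrier (sp N i))) \<and>
          (\<forall>i j. i \<le> j \<and> j \<le> m \<longrightarrow>
             (\<forall>x \<in> carrier (sp M i). \<phi> j (tr M i j x) = tr N i j (\<phi> i x))))"

text \<open>Intervals of the index set \<open>{0..m}\<close>; half-open intervals \<open>[a, b)\<close> are \<open>{a..<b}\<close> with \<open>b \<le> m + 1\<close>.\<close>

definition index_interval :: "nat \<Rightarrow> nat set \<Rightarrow> bool" where
  "index_interval m J \<longleftrightarrow>
     J \<noteq> {} \<and> J \<subseteq> {0..m} \<and> (\<forall>a\<in>J. \<forall>b\<in>J. \<forall>c. a \<le> c \<and> c \<le> b \<longrightarrow> c \<in> J)"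

text \<open>
  The fields \<open>mult\<close> and \<open>one\<close> inherited from the ring record are irrelevant for modules and are
  left unspecified throughout.
\<close>

definition interval_module :: "'k ring \<Rightarrow> nat set \<Rightarrow> ('k, 'k) pmod" where
  "interval_module F J =
     \<lparr>sp = (\<lambda>i. \<lparr>carrier = (if i \<in> J then carrier F else {\<zero>\<^bsub>F\<^esub>}),
                 monoid.mult = undefined, one = undefined,
                 zero = zero F, add = add F, smult = monoid.mult F\<rparr>),
      tr = (\<lambda>i j x. if i \<in> J \<and> j \<in> J then x else \<zero>\<^bsub>F\<^esub>)\<rparr>"

definition pmod_sum :: "nat \<Rightarrow> (nat \<Rightarrow> ('k, 'a) pmod) \<Rightarrow> ('k, nat \<Rightarrow> 'a) pmod" where
  "pmod_sum n M =
     \<lparr>sp = (\<lambda>i. \<lparr>carrier = (\<Pi>\<^sub>E k \<in> {..<n}. carrier (sp (M k) i)),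
                 monoid.mult = undefined, one = undefined,
                 zero = (\<lambda>k\<in>{..<n}. \<zero>\<^bsub>sp (M k) i\<^esub>),
                 add = (\<lambda>x y. \<lambda>k\<in>{..<n}. x k \<oplus>\<^bsub>sp (M k) i\<^esub> y k),
                 smult = (\<lambda>a x. \<lambda>k\<in>{..<n}. a \<odot>\<^bsub>sp (M k) i\<^esub> x k)\<rparr>),
      tr = (\<lambda>i j x. \<lambda>k\<in>{..<n}. tr (M k) i j (x k))\<rparr>"

definition is_barcode :: "'k ring \<Rightarrow> nat \<Rightarrow> ('k, 'a) pmod \<Rightarrow> nat set multiset \<Rightarrow> bool" where
  "is_barcode F m M B \<longleftrightarrow>
     persistence_module F m M \<and>
     (\<exists>Js. mset Js = B \<and> (\<forall>J \<in> set Js. index_interval m J) \<and>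
           pmod_iso F m M (pmod_sum (length Js) (\<lambda>k. interval_module F (Js ! k))))"

definition barcode :: "'k ring \<Rightarrow> nat \<Rightarrow> ('k, 'a) pmod \<Rightarrow> nat set multiset" where
  "barcode F m M = (THE B. is_barcode F m M B)"


section \<open>Simplicial homology\<close>

text \<open>
  A \<open>d\<close>-chain of \<open>X\<close> is its coefficient function, extended by zero to all sets; so for \<open>X \<subseteq> Y\<close> the
  chains of \<open>X\<close> are literally chains of \<open>Y\<close>.
\<close>

definition chain_space :: "'k ring \<Rightarrow> 'v set set \<Rightarrow> nat \<Rightarrow> ('k, 'v set \<Rightarrow> 'k) module" where
  "chain_space F X d =
     \<lparr>carrier = {c. (\<forall>\<sigma>. c \<sigma> \<in> carrier F) \<and> (\<forall>\<sigma>. \<not> (\<sigma> \<in> X \<and> sdim \<sigma> = d) \<longrightarrow> c \<sigma> = \<zero>\<^bsub>F\<^esub>)},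
      monoid.mult = undefined, one = undefined,
      zero = (\<lambda>\<sigma>. \<zero>\<^bsub>F\<^esub>),
      add = (\<lambda>c c' \<sigma>. c \<sigma> \<oplus>\<^bsub>F\<^esub> c' \<sigma>),
      smult = (\<lambda>a c \<sigma>. a \<otimes>\<^bsub>F\<^esub> c \<sigma>)\<rparr>"

text \<open>
  Every simplex is oriented by increasing vertex number, where \<open>\<nu>\<close> is an injective numbering of the
  vertices.  If \<open>v\<close> is the vertex of \<open>\<tau>\<close> missing in its facet \<open>\<rho>\<close> and \<open>k\<close> is the position of \<open>v\<close> in
  \<open>\<tau> = [v\<^sub>0, \<dots>, v\<^sub>n]\<close>, then \<open>\<rho>\<close> occurs in the boundary of \<open>\<tau>\<close> with sign \<open>(-1)\<^sup>k\<close>.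
\<close>

definition incidence :: "'k ring \<Rightarrow> ('v \<Rightarrow> nat) \<Rightarrow> 'v set \<Rightarrow> 'v set \<Rightarrow> 'k" where
  "incidence F \<nu> \<rho> \<tau> =
     (let v = the_elem (\<tau> - \<rho>)
      in if even (card {w \<in> \<tau>. \<nu> w < \<nu> v}) then \<one>\<^bsub>F\<^esub> else \<ominus>\<^bsub>F\<^esub> \<one>\<^bsub>F\<^esub>)"

text \<open>As the empty set is not a simplex, the boundary of a \<open>0\<close>-chain is zero (unreduced homology).\<close>

definition boundary ::
    "'k ring \<Rightarrow> ('v \<Rightarrow> nat) \<Rightarrow> 'v set set \<Rightarrow> ('v set \<Rightarrow> 'k) \<Rightarrow> 'v set \<Rightarrow> 'k" where
  "boundary F \<nu> X c =
     (\<lambda>\<rho>. if \<rho> \<in> X then \<Oplus>\<^bsub>F\<^esub>\<tau> \<in> {\<tau>. facet X \<rho> \<tau>}. incidence F \<nu> \<rho> \<tau> \<otimes>\<^bsub>F\<^esub> c \<tau> else \<zero>\<^bsub>F\<^esub>)"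

definition cycles :: "'k ring \<Rightarrow> ('v \<Rightarrow> nat) \<Rightarrow> 'v set set \<Rightarrow> nat \<Rightarrow> ('v set \<Rightarrow> 'k) set" where
  "cycles F \<nu> X d = {c \<in> carrier (chain_space F X d). boundary F \<nu> X c = (\<lambda>\<sigma>. \<zero>\<^bsub>F\<^esub>)}"

definition boundaries :: "'k ring \<Rightarrow> ('v \<Rightarrow> nat) \<Rightarrow> 'v set set \<Rightarrow> nat \<Rightarrow> ('v set \<Rightarrow> 'k) set" where
  "boundaries F \<nu> X d = boundary F \<nu> X ` carrier (chain_space F X (Suc d))"

definition quotient_space :: "('k, 'a) module \<Rightarrow> 'a set \<Rightarrow> ('k, 'a set) module" where
  "quotient_space V U =
     \<lparr>carrier = a_rcosets\<^bsub>V\<^esub> U,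
      monoid.mult = undefined, one = undefined,
      zero = U,
      add = set_add V,
      smult = (\<lambda>a S. \<Union>x\<in>S. U +>\<^bsub>V\<^esub> (a \<odot>\<^bsub>V\<^esub> x))\<rparr>"

definition homology ::
    "'k ring \<Rightarrow> ('v \<Rightarrow> nat) \<Rightarrow> 'v set set \<Rightarrow> nat \<Rightarrow> ('k, ('v set \<Rightarrow> 'k) set) module" where
  "homology F \<nu> X d =
     quotient_space ((chain_space F X d)\<lparr>carrier := cycles F \<nu> X d\<rparr>) (boundaries F \<nu> X d)"

text \<open>
  The map \<open>H\<^sub>d(K\<^sub>i) \<rightarrow> H\<^sub>d(K\<^sub>j)\<close> induced by the inclusion sends a class \<open>S = z + B\<^sub>d(K\<^sub>i)\<close> to
  \<open>z + B\<^sub>d(K\<^sub>j)\<close>; since \<open>B\<^sub>d(K\<^sub>i) \<subseteq> B\<^sub>d(K\<^sub>j)\<close>, this is the sum of the sets \<open>B\<^sub>d(K\<^sub>j)\<close> and \<open>S\<close>.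
\<close>

definition homology_pmod ::
    "'k ring \<Rightarrow> ('v \<Rightarrow> nat) \<Rightarrow> 'v set list \<Rightarrow> nat \<Rightarrow> ('k, ('v set \<Rightarrow> 'k) set) pmod" where
  "homology_pmod F \<nu> \<sigma>s d =
     \<lparr>sp = (\<lambda>i. homology F \<nu> (filt \<sigma>s i) d),
      tr = (\<lambda>i j S. boundaries F \<nu> (filt \<sigma>s j) d <+>\<^bsub>chain_space F (filt \<sigma>s j) d\<^esub> S)\<rparr>"

text \<open>
  \<open>H\<^sub>*\<close> is the direct sum of the \<open>H\<^sub>d\<close>, so its barcode is the union of the barcodes in all
  degrees \<open>d\<close>.
\<close>

definition persistence_pair ::
    "'k ring \<Rightarrow> ('v \<Rightarrow> nat) \<Rightarrow> 'v set list \<Rightarrow> 'v set \<Rightarrow> 'v set \<Rightarrow> bool" where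
  "persistence_pair F \<nu> \<sigma>s \<sigma> \<tau> \<longleftrightarrow>
     (\<exists>i \<in> {1..length \<sigma>s}. \<exists>j \<in> {1..length \<sigma>s}. \<sigma> = \<sigma>s ! (i - 1) \<and> \<tau> = \<sigma>s ! (j - 1) \<and>
        (\<exists>d. {i..<j} \<in># barcode F (length \<sigma>s) (homology_pmod F \<nu> \<sigma>s d)))"

end

theory Submission
  imports Defs
begin

text \<open>
  Order the basis of the total chain complex by the filtration.  A triangular change of basis turns
  the boundary operator into a partial matching \<open>j \<mapsto> i\<close>; in such a basis the homology of every
  \<open>K\<^sub>n\<close> is read off, and the persistence module splits into the intervals \<open>[i, j)\<close> of matched indices
  and \<open>[i, m]\<close> of unmatched cycles.  The barcode is unique because the ranks of the structure
  maps count the intervals containing two given indices.  For an apparent pair \<open>(\<sigma>\<^sub>i, \<sigma>\<^sub>j)\<close>, the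
  leading term of \<open>\<partial>\<sigma>\<^sub>j\<close> is \<open>\<sigma>\<^sub>i\<close>, so \<open>i\<close> is matched with some index at most \<open>j\<close>; it cannot be
  smaller than \<open>j\<close>, as \<open>\<sigma>\<^sub>i\<close> does not occur in the boundary of any chain of \<open>K\<^bsub>j-1\<^esub>\<close>.
\<close>

section \<open>Reduced coordinates of a filtered chain complex\<close>

text \<open>The new basis is carried through the reduction only by its dual, the family of
  coordinate functionals \<open>a k\<close>. A change of basis is then a formula for these
  functionals, and a basis vector is recovered where needed by prescribing its coordinates. All
  degrees are reduced together in one complex, whereas each persistence module lives in a single
  degree. Triangularity is therefore stated among simplices of equal degree; by linearity this
  forces every functional to ignore the other degrees. Triangularity does two jobs. It makes the
  coordinates compatible with all stages of the filtration at once, so that a single matching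
  describes every homology group and every map between them. It also makes the last nonzero
  coefficient of a chain visible in the coordinates, which ties the boundary of the simplex
  \<open>\<sigma>\<^sub>j\<close> itself to the abstract matching. Since \<open>barcode\<close> is a
  definite description, both existence and uniqueness of the decomposition are required before a
  single interval can be shown to belong to it.\<close>

definition fun_space :: "('k, 'm) ring_scheme \<Rightarrow> 'x set \<Rightarrow> ('x \<Rightarrow> 'k) set" where
  "fun_space R X = {c. (\<forall>x. c x \<in> carrier R) \<and> (\<forall>x. x \<notin> X \<longrightarrow> c x = \<zero>\<^bsub>R\<^esub>)}"

definition functional :: "('k, 'm) ring_scheme \<Rightarrow> 'x set \<Rightarrow> (('x \<Rightarrow> 'k) \<Rightarrow> 'k) \<Rightarrow> bool" where
  "functional R X a \<longleftrightarrow>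
     (\<forall>c \<in> fun_space R X. a c \<in> carrier R) \<and>
     (\<forall>c \<in> fun_space R X. \<forall>c' \<in> fun_space R X. a (\<lambda>x. c x \<oplus>\<^bsub>R\<^esub> c' x) = a c \<oplus>\<^bsub>R\<^esub> a c') \<and>
     (\<forall>s \<in> carrier R. \<forall>c \<in> fun_space R X. a (\<lambda>x. s \<otimes>\<^bsub>R\<^esub> c x) = s \<otimes>\<^bsub>R\<^esub> a c)"

lemma fun_spaceI:
  "\<lbrakk>\<And>x. c x \<in> carrier R; \<And>x. x \<notin> X \<Longrightarrow> c x = \<zero>\<^bsub>R\<^esub>\<rbrakk> \<Longrightarrow> c \<in> fun_space R X"
  by (simp add: fun_space_def)

lemma fun_space_closed: "c \<in> fun_space R X \<Longrightarrow> c x \<in> carrier R"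
  by (simp add: fun_space_def)

lemma fun_space_outside: "\<lbrakk>c \<in> fun_space R X; x \<notin> X\<rbrakk> \<Longrightarrow> c x = \<zero>\<^bsub>R\<^esub>"
  by (simp add: fun_space_def)

lemma fun_space_mono: "X \<subseteq> Y \<Longrightarrow> fun_space R X \<subseteq> fun_space R Y"
  by (auto simp: fun_space_def)

context ring
begin

lemma fun_space_zero: "(\<lambda>x. \<zero>) \<in> fun_space R X"
  by (simp add: fun_space_def)

lemma fun_space_add:
  "\<lbrakk>c \<in> fun_space R X; c' \<in> fun_space R X\<rbrakk> \<Longrightarrow> (\<lambda>x. c x \<oplus> c' x) \<in> fun_space R X"
  by (simp add: fun_space_def)

lemma fun_space_smult:
  "\<lbrakk>s \<in> carrier R; c \<in> fun_space R X\<rbrakk> \<Longrightarrow> (\<lambda>x. s \<otimes> c x) \<in> fun_space R X"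
  by (simp add: fun_space_def)

lemma functional_closed: "\<lbrakk>functional R X a; c \<in> fun_space R X\<rbrakk> \<Longrightarrow> a c \<in> carrier R"
  by (simp add: functional_def)

lemma functional_add:
  "\<lbrakk>functional R X a; c \<in> fun_space R X; c' \<in> fun_space R X\<rbrakk> \<Longrightarrow>
     a (\<lambda>x. c x \<oplus> c' x) = a c \<oplus> a c'"
  by (simp add: functional_def)

lemma functional_smult:
  "\<lbrakk>functional R X a; s \<in> carrier R; c \<in> fun_space R X\<rbrakk> \<Longrightarrow> a (\<lambda>x. s \<otimes> c x) = s \<otimes> a c"
  by (simp add: functional_def)

lemma functional_zero: "functional R X a \<Longrightarrow> a (\<lambda>x. \<zero>) = \<zero>"
  using functional_smult[of X a \<zero> "\<lambda>x. \<zero>"] functional_closed[of X a "\<lambda>x. \<zero>"]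
  by (simp add: fun_space_zero)

lemma functional_eval: "functional R X (\<lambda>c. c x)"
  by (auto simp: functional_def fun_space_def)

end

context cring
begin

lemma functional_comb:
  assumes "functional R X a" "functional R X b" "s \<in> carrier R"
  shows "functional R X (\<lambda>c. a c \<oplus> s \<otimes> b c)"
  using assms by (auto simp: functional_def fun_space_def a_ac m_ac r_distr)

lemma functional_scale:
  assumes "functional R X a" "s \<in> carrier R"
  shows "functional R X (\<lambda>c. s \<otimes> a c)"
  using assms by (auto simp: functional_def fun_space_def m_ac r_distr)

end

text \<open>The grading enters only through \<open>D_deg\<close>: a coefficient of a boundary sees
  nothing but coefficients one degree higher. \<open>D_filt\<close> is strict, a boundary loses the
  last position of its chain; this is why a matched index is always larger than its partner.\<close>

locale filtered_complex = field R for R :: "('k, 'm) ring_scheme" (structure) +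
  fixes xs :: "'x list" and deg :: "'x \<Rightarrow> nat" and D :: "('x \<Rightarrow> 'k) \<Rightarrow> 'x \<Rightarrow> 'k"
  assumes distinct: "distinct xs"
    and D_add: "\<And>c c'. \<lbrakk>c \<in> fun_space R (set xs); c' \<in> fun_space R (set xs)\<rbrakk> \<Longrightarrow>
      D (\<lambda>x. c x \<oplus> c' x) = (\<lambda>x. D c x \<oplus> D c' x)"
    and D_smult: "\<And>s c. \<lbrakk>s \<in> carrier R; c \<in> fun_space R (set xs)\<rbrakk> \<Longrightarrow>
      D (\<lambda>x. s \<otimes> c x) = (\<lambda>x. s \<otimes> D c x)"
    and D_D: "\<And>c. c \<in> fun_space R (set xs) \<Longrightarrow> D (D c) = (\<lambda>x. \<zero>)"
    and D_filt: "\<And>n c. \<lbrakk>n < length xs; c \<in> fun_space R (set (take (Suc n) xs))\<rbrakk> \<Longrightarrow>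
      D c \<in> fun_space R (set (take n xs))"
    and D_deg: "\<And>c x. \<lbrakk>c \<in> fun_space R (set xs); \<And>y. deg y = Suc (deg x) \<Longrightarrow> c y = \<zero>\<rbrakk> \<Longrightarrow>
      D c x = \<zero>"
begin

abbreviation "V \<equiv> fun_space R (set xs)"
abbreviation "V_upto n \<equiv> fun_space R (set (take n xs))"

definition unit_chain :: "nat \<Rightarrow> 'x \<Rightarrow> 'k" where
  "unit_chain n = (\<lambda>x. if x = xs ! n then \<one> else \<zero>)"

lemma V_upto_V: "c \<in> V_upto n \<Longrightarrow> c \<in> V"
  using fun_space_mono[OF set_take_subset] by blast

lemma V_upto_mono: "\<lbrakk>c \<in> V_upto n; n \<le> n'\<rbrakk> \<Longrightarrow> c \<in> V_upto n'"
  using fun_space_mono[OF set_take_subset_set_take] by blast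

lemma V_upto_length: "V_upto (length xs) = V"
  by simp

lemma nth_notin_take: "\<lbrakk>n \<le> k; k < length xs\<rbrakk> \<Longrightarrow> xs ! k \<notin> set (take n xs)"
  using distinct by (auto simp: in_set_conv_nth nth_eq_iff_index_eq)

lemma V_upto_nth: "\<lbrakk>c \<in> V_upto n; n \<le> k; k < length xs\<rbrakk> \<Longrightarrow> c (xs ! k) = \<zero>"
  using fun_space_outside nth_notin_take by metis

lemma V_eqI:
  assumes "c \<in> V" "c' \<in> V" "\<And>k. k < length xs \<Longrightarrow> c (xs ! k) = c' (xs ! k)"
  shows "c = c'"
proof
  fix x
  show "c x = c' x"
  proof (cases "x \<in> set xs")
    case True
    then show ?thesis
      using assms(3) by (auto simp: in_set_conv_nth)
  next
    case False
    then show ?thesis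
      using assms(1,2) fun_space_outside by metis
  qed
qed

lemma unit_chain_V_upto: "n < length xs \<Longrightarrow> unit_chain n \<in> V_upto (Suc n)"
  by (rule fun_spaceI) (auto simp: unit_chain_def take_Suc_conv_app_nth)

lemma unit_chain_V: "n < length xs \<Longrightarrow> unit_chain n \<in> V"
  using unit_chain_V_upto V_upto_V by blast

lemma unit_chain_nth:
  "\<lbrakk>n < length xs; k < length xs\<rbrakk> \<Longrightarrow> unit_chain n (xs ! k) = (if k = n then \<one> else \<zero>)"
  using distinct by (simp add: unit_chain_def nth_eq_iff_index_eq)

lemma V_upto_Suc_decomp:
  assumes "n < length xs" "z \<in> V_upto (Suc n)"
  obtains z' where "z' \<in> V_upto n" "z = (\<lambda>x. z' x \<oplus> z (xs ! n) \<otimes> unit_chain n x)"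
proof
  let ?z = "z(xs ! n := \<zero>)"
  show "?z \<in> V_upto n"
    using assms by (auto simp: fun_space_def take_Suc_conv_app_nth)
  show "z = (\<lambda>x. ?z x \<oplus> z (xs ! n) \<otimes> unit_chain n x)"
    using assms(2) fun_space_closed[OF assms(2)] by (auto simp: unit_chain_def)
qed

lemma D_V_upto:
  assumes "c \<in> V_upto n"
  shows "D c \<in> V_upto n"
proof (cases "n < length xs")
  case True
  then show ?thesis
    using D_filt V_upto_mono[OF assms] by auto
next
  \<comment> \<open>Past the end of the list \<open>D_filt\<close> says nothing about
    \<open>n\<close> itself. It is applied at the last position instead, and for the empty list
    \<open>D_deg\<close> takes its place.\<close>
  case False
  show ?thesis
  proof (cases "length xs")
    case 0
    then show ?thesis
      using assms D_deg[of c] by (auto simp: fun_space_def)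
  next
    case (Suc l)
    have "D c \<in> V_upto l"
      using D_filt[of l c] False assms Suc by simp
    then have "D c \<in> V_upto (length xs)"
      using V_upto_mono[of "D c" l "length xs"] Suc by simp
    then show ?thesis
      using False by simp
  qed
qed

lemma D_V: "c \<in> V \<Longrightarrow> D c \<in> V"
  using D_V_upto[of c "length xs"] by simp

end

text \<open>
  The functionals \<open>a k\<close> are the coordinates of a basis change that is triangular with respect to the
  filtration, so that \<open>D\<close> acts on coordinates by a partial matching: \<open>br j = Some k\<close> records that
  the \<open>j\<close>-th basis vector is mapped to the \<open>k\<close>-th one.  This is required only on the first \<open>n\<close>
  simplices; the remaining coordinates are still the original ones.
\<close>

locale reduction = filtered_complex R xs deg D
  for R :: "('k, 'm) ring_scheme" (structure) and xs :: "'x list" and deg D +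
  fixes n :: nat and a :: "nat \<Rightarrow> ('x \<Rightarrow> 'k) \<Rightarrow> 'k" and br :: "nat \<Rightarrow> nat option"
  assumes n_le: "n \<le> length xs"
    and functional_a: "\<And>k. k < length xs \<Longrightarrow> functional R (set xs) (a k)"
    and triangular: "\<And>k. k < length xs \<Longrightarrow> \<exists>u \<in> carrier R - {\<zero>}. \<forall>z \<in> V.
      (\<forall>l < length xs. k < l \<and> deg (xs ! l) = deg (xs ! k) \<longrightarrow> z (xs ! l) = \<zero>) \<longrightarrow>
      a k z = u \<otimes> z (xs ! k)"
    and a_ge: "\<And>k z. \<lbrakk>n \<le> k; k < length xs; z \<in> V\<rbrakk> \<Longrightarrow> a k z = z (xs ! k)"
    and a_less: "\<And>k z. \<lbrakk>k < n; z \<in> V; \<And>l. l < n \<Longrightarrow> z (xs ! l) = \<zero>\<rbrakk> \<Longrightarrow> a k z = \<zero>"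
    and br_less: "\<And>j k. br j = Some k \<Longrightarrow> k < j \<and> j < n"
    and br_deg: "\<And>j k. br j = Some k \<Longrightarrow> deg (xs ! j) = Suc (deg (xs ! k))"
    and br_inj: "\<And>j j' k. \<lbrakk>br j = Some k; br j' = Some k\<rbrakk> \<Longrightarrow> j = j'"
    and a_D_paired: "\<And>j k z. \<lbrakk>br j = Some k; z \<in> V_upto n\<rbrakk> \<Longrightarrow> a k (D z) = a j z"
    and a_D_unpaired: "\<And>k z. \<lbrakk>k < length xs; Some k \<notin> range br; z \<in> V_upto n\<rbrakk> \<Longrightarrow> a k (D z) = \<zero>"
begin

lemma a_closed: "\<lbrakk>k < length xs; z \<in> V\<rbrakk> \<Longrightarrow> a k z \<in> carrier R"
  using functional_a functional_closed by blast

lemma a_zero: "k < length xs \<Longrightarrow> a k (\<lambda>x. \<zero>) = \<zero>"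
  using functional_a functional_zero by blast

text \<open>A coordinate sees only coefficients of its own degree, at its own or later positions.
  Both the grading and the filtration reach the new coordinates through this fact.\<close>

lemma a_vanish:
  assumes "k < length xs" "z \<in> V"
    and "\<And>l. \<lbrakk>l < length xs; k \<le> l; deg (xs ! l) = deg (xs ! k)\<rbrakk> \<Longrightarrow> z (xs ! l) = \<zero>"
  shows "a k z = \<zero>"
proof -
  obtain u where u: "u \<in> carrier R - {\<zero>}" "a k z = u \<otimes> z (xs ! k)"
    using triangular[OF assms(1)] assms(2,3) by (meson less_imp_le)
  then show ?thesis
    using assms(1,3) by simp
qed

end

text \<open>At the start the coordinates are the coefficients and nothing is matched; the conditions
  on \<open>D\<close> then speak of the zero chain only.\<close>

lemma (in filtered_complex) reduction_0: "reduction R xs deg D 0 (\<lambda>k z. z (xs ! k)) (\<lambda>_. None)"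
proof unfold_locales
  show "\<exists>u\<in>carrier R - {\<zero>}. \<forall>z\<in>V.
      (\<forall>l<length xs. k < l \<and> deg (xs ! l) = deg (xs ! k) \<longrightarrow> z (xs ! l) = \<zero>) \<longrightarrow>
      z (xs ! k) = u \<otimes> z (xs ! k)" for k
    by (rule bexI[of _ \<one>]) (auto simp: fun_space_closed)
  show "D z (xs ! k) = \<zero>" if "z \<in> V_upto 0" "k < length xs" for k z
    using D_V_upto[OF that(1)] V_upto_nth that(2) by blast
qed (auto intro: functional_eval)

section \<open>One reduction step: adjoining the simplex at position \<open>n\<close>\<close>

context reduction
begin

context
  assumes n: "n < length xs"
begin

abbreviation "dcoeff k \<equiv> a k (D (unit_chain n))"

lemma D_unit: "D (unit_chain n) \<in> V_upto n"
  using D_filt n unit_chain_V_upto by blast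

lemma dcoeff_closed: "k < length xs \<Longrightarrow> dcoeff k \<in> carrier R"
  using a_closed D_unit V_upto_V by blast

lemma dcoeff_ge: "\<lbrakk>n \<le> k; k < length xs\<rbrakk> \<Longrightarrow> dcoeff k = \<zero>"
  using a_ge[OF _ _ V_upto_V[OF D_unit]] V_upto_nth[OF D_unit] by simp

lemma dcoeff_deg:
  assumes "k < length xs" "dcoeff k \<noteq> \<zero>"
  shows "deg (xs ! n) = Suc (deg (xs ! k))"
proof (rule ccontr)
  assume neq: "deg (xs ! n) \<noteq> Suc (deg (xs ! k))"
  have "D (unit_chain n) (xs ! l) = \<zero>" if "deg (xs ! l) = deg (xs ! k)" for l
    using that neq by (intro D_deg unit_chain_V n) (auto simp: unit_chain_def)
  then show False
    using a_vanish[OF assms(1) V_upto_V[OF D_unit]] assms(2) by blast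
qed

text \<open>The boundary of the new simplex is a cycle, and its coordinate at a death index equals a
  coordinate of its own boundary.\<close>

lemma dcoeff_death:
  assumes "br j = Some k"
  shows "dcoeff j = \<zero>"
proof -
  have "dcoeff j = a k (D (D (unit_chain n)))"
    using a_D_paired[OF assms D_unit] by simp
  also have "\<dots> = \<zero>"
    using D_D[OF unit_chain_V[OF n]] a_zero br_less[OF assms] n_le by simp
  finally show ?thesis .
qed

text \<open>
  The new basis vector is \<open>xs ! n\<close> minus those earlier basis vectors whose boundaries cancel the
  matched part of the boundary of \<open>xs ! n\<close>; these are the coordinates after adjoining it.
\<close>

definition ext_a :: "nat \<Rightarrow> ('x \<Rightarrow> 'k) \<Rightarrow> 'k" where
  "ext_a j z = (case br j of None \<Rightarrow> a j z | Some k \<Rightarrow> a j z \<oplus> dcoeff k \<otimes> z (xs ! n))"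

lemma functional_ext_a:
  assumes "k < length xs"
  shows "functional R (set xs) (ext_a k)"
proof (cases "br k")
  case None
  then show ?thesis
    using functional_a[OF assms] by (simp add: ext_a_def[abs_def])
next
  case (Some q)
  then show ?thesis
    using functional_comb[OF functional_a[OF assms] functional_eval dcoeff_closed]
      br_less[OF Some] n_le by (simp add: ext_a_def[abs_def])
qed

lemma ext_a_closed: "\<lbrakk>k < length xs; z \<in> V\<rbrakk> \<Longrightarrow> ext_a k z \<in> carrier R"
  using functional_ext_a functional_closed by blast

text \<open>The correction term contains the coefficient at \<open>xs ! n\<close>. If
  \<open>xs ! n\<close> has the degree of \<open>xs ! k\<close>, this coefficient vanishes by
  assumption, because \<open>k < n\<close>; otherwise its factor \<open>dcoeff q\<close> vanishes
  for reasons of degree.\<close>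

lemma ext_a_triangular:
  assumes "k < length xs"
  shows "\<exists>u \<in> carrier R - {\<zero>}. \<forall>z \<in> V.
      (\<forall>l < length xs. k < l \<and> deg (xs ! l) = deg (xs ! k) \<longrightarrow> z (xs ! l) = \<zero>) \<longrightarrow>
      ext_a k z = u \<otimes> z (xs ! k)"
proof -
  obtain u where u: "u \<in> carrier R - {\<zero>}"
    "\<And>z. \<lbrakk>z \<in> V; \<forall>l < length xs. k < l \<and> deg (xs ! l) = deg (xs ! k) \<longrightarrow> z (xs ! l) = \<zero>\<rbrakk> \<Longrightarrow>
      a k z = u \<otimes> z (xs ! k)"
    using triangular[OF assms] by blast
  have "ext_a k z = u \<otimes> z (xs ! k)"
    if z: "z \<in> V" "\<forall>l < length xs. k < l \<and> deg (xs ! l) = deg (xs ! k) \<longrightarrow> z (xs ! l) = \<zero>" for z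
  proof (cases "br k")
    case (Some q)
    have "dcoeff q \<otimes> z (xs ! n) = \<zero>"
    proof (cases "deg (xs ! n) = deg (xs ! k)")
      case True
      then show ?thesis
        using z n br_less[OF Some] dcoeff_closed by simp
    next
      case False
      then have "dcoeff q = \<zero>"
        using dcoeff_deg[of q] br_deg[OF Some] br_less[OF Some] n by force
      then show ?thesis
        using fun_space_closed[OF z(1)] by simp
    qed
    then show ?thesis
      using u z Some by (simp add: ext_a_def fun_space_closed)
  qed (use u z in \<open>simp add: ext_a_def\<close>)
  then show ?thesis
    using u(1) by blast
qed

lemma ext_a_ge: "\<lbrakk>n \<le> k; k < length xs; z \<in> V\<rbrakk> \<Longrightarrow> ext_a k z = z (xs ! k)"
  using br_less[of k] by (auto simp: ext_a_def a_ge split: option.split)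

lemma ext_a_less:
  assumes "k \<le> n" "z \<in> V" "\<And>l. l \<le> n \<Longrightarrow> z (xs ! l) = \<zero>"
  shows "ext_a k z = \<zero>"
proof (cases "k = n")
  case True
  then show ?thesis
    using ext_a_ge assms n by simp
next
  case False
  then show ?thesis
    using a_less[of k z] assms n br_less[of k]
    by (auto simp: ext_a_def dcoeff_closed split: option.split)
qed

text \<open>The correction is a multiple of the coefficient at \<open>xs ! n\<close>, and by
  strictness of the filtration the boundary of a chain on the first \<open>n + 1\<close> simplices
  has none there.\<close>

lemma ext_a_D_eq_a_D:
  assumes "k < length xs" "z \<in> V_upto (Suc n)"
  shows "ext_a k (D z) = a k (D z)"
proof -
  have Dz: "D z \<in> V_upto n"
    using D_filt n assms(2) by blast
  then have "D z (xs ! n) = \<zero>"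
    using V_upto_nth n by blast
  then show ?thesis
    using a_closed[OF assms(1) V_upto_V[OF Dz]] br_less[of k] n
    by (auto simp: ext_a_def dcoeff_closed split: option.split)
qed

lemma a_D_decomp:
  assumes "k < length xs" "z' \<in> V_upto n" "s \<in> carrier R"
  shows "a k (D (\<lambda>x. z' x \<oplus> s \<otimes> unit_chain n x)) = a k (D z') \<oplus> s \<otimes> dcoeff k"
proof -
  have u: "unit_chain n \<in> V"
    by (rule unit_chain_V[OF n])
  have "D (\<lambda>x. z' x \<oplus> s \<otimes> unit_chain n x) = (\<lambda>x. D z' x \<oplus> s \<otimes> D (unit_chain n) x)"
    using D_add[OF V_upto_V[OF assms(2)] fun_space_smult[OF assms(3) u]] D_smult[OF assms(3) u]
    by simp
  then show ?thesis
    using functional_add[OF functional_a[OF assms(1)] D_V[OF V_upto_V[OF assms(2)]]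
        fun_space_smult[OF assms(3) D_V[OF u]]]
      functional_smult[OF functional_a[OF assms(1)] assms(3) D_V[OF u]]
    by simp
qed

text \<open>After splitting off the multiple of the new simplex from \<open>z\<close>, both sides
  gain the same term: on the left from the boundary of the new simplex, on the right from the
  correction in \<open>ext_a\<close>. The old coordinate \<open>a j\<close> does not see the new
  simplex at all.\<close>

lemma ext_a_D_paired:
  assumes jk: "br j = Some k" and z: "z \<in> V_upto (Suc n)"
  shows "ext_a k (D z) = ext_a j z"
proof -
  have less: "k < length xs" "j < length xs" "j < n"
    using br_less[OF jk] n by auto
  obtain z' where z': "z' \<in> V_upto n" "z = (\<lambda>x. z' x \<oplus> z (xs ! n) \<otimes> unit_chain n x)"
    using V_upto_Suc_decomp[OF n z] .
  have t: "z (xs ! n) \<in> carrier R"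
    using z by (rule fun_space_closed)
  have u: "unit_chain n \<in> V"
    by (rule unit_chain_V[OF n])
  have 1: "ext_a k (D z) = a j z' \<oplus> z (xs ! n) \<otimes> dcoeff k"
    using ext_a_D_eq_a_D[OF less(1) z] a_D_decomp[OF less(1) z'(1) t] a_D_paired[OF jk z'(1)] z'(2)
    by simp
  have "a j (unit_chain n) = \<zero>"
    using unit_chain_nth n less by (intro a_less u) auto
  then have "a j z = a j z'"
    using z'(2) functional_add[OF functional_a[OF less(2)] V_upto_V[OF z'(1)] fun_space_smult[OF t u]]
      functional_smult[OF functional_a[OF less(2)] t u] a_closed[OF less(2) V_upto_V[OF z'(1)]] t
    by simp
  then show ?thesis
    using 1 jk t dcoeff_closed[OF less(1)] by (simp add: ext_a_def m_comm)
qed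

text \<open>Unmatched coordinates vanish on old boundaries, so only the new simplex contributes.
  Whether some of these contributions is nonzero decides between a birth and a death.\<close>

lemma ext_a_D_unpaired:
  assumes k: "k < length xs" "Some k \<notin> range br" and z: "z \<in> V_upto (Suc n)"
  shows "ext_a k (D z) = z (xs ! n) \<otimes> dcoeff k"
proof -
  obtain z' where z': "z' \<in> V_upto n" "z = (\<lambda>x. z' x \<oplus> z (xs ! n) \<otimes> unit_chain n x)"
    using V_upto_Suc_decomp[OF n z] .
  have t: "z (xs ! n) \<in> carrier R"
    using z by (rule fun_space_closed)
  show ?thesis
    using ext_a_D_eq_a_D[OF k(1) z] a_D_decomp[OF k(1) z'(1) t] a_D_unpaired[OF k z'(1)] z'(2)
      t dcoeff_closed[OF k(1)] by simp
qed

text \<open>When no unmatched coordinate is left in its boundary, the corrected new basis vector is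
  a cycle. It opens a class, and the matching stays as it is.\<close>

lemma reduction_Suc_birth:
  assumes "\<And>k. \<lbrakk>k < length xs; Some k \<notin> range br\<rbrakk> \<Longrightarrow> dcoeff k = \<zero>"
  shows "reduction R xs deg D (Suc n) ext_a br"
proof unfold_locales
  show "ext_a k (D z) = \<zero>" if "k < length xs" "Some k \<notin> range br" "z \<in> V_upto (Suc n)" for k z
    using ext_a_D_unpaired[OF that] assms[OF that(1,2)] fun_space_closed[OF that(3)] by simp
  show "k < j \<and> j < Suc n" if "br j = Some k" for j k
    using br_less[OF that] by simp
qed (use n functional_ext_a ext_a_triangular ext_a_ge ext_a_less br_deg br_inj ext_a_D_paired in
    \<open>simp_all add: less_Suc_eq_le\<close>)

text \<open>The largest unmatched index of the boundary has to be the partner of \<open>n\<close>.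
  The change of basis then alters, apart from a rescaling of coordinate \<open>i\<close>, only
  coordinates \<open>k < i\<close>, by multiples of coordinate \<open>i\<close>, which looks at
  positions from \<open>i\<close> on; hence triangularity survives.\<close>

lemma reduction_Suc_death:
  assumes i: "i < length xs" "Some i \<notin> range br" "dcoeff i \<noteq> \<zero>"
    and max: "\<And>k. \<lbrakk>k < length xs; Some k \<notin> range br; dcoeff k \<noteq> \<zero>\<rbrakk> \<Longrightarrow> k \<le> i"
  shows "\<exists>f. reduction R xs deg D (Suc n) f (br(n \<mapsto> i))"
proof -
  define r where "r = inv (dcoeff i)"
  have r: "r \<in> carrier R" "r \<otimes> dcoeff i = \<one>" "r \<noteq> \<zero>"
    using dcoeff_closed[OF i(1)] i(3) field_Units Units_inv_Units[of "dcoeff i"] unfolding r_def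
    by auto
  have i_less: "i < n"
    using dcoeff_ge[of i] i by force
  have deg_i: "deg (xs ! n) = Suc (deg (xs ! i))"
    using dcoeff_deg i by blast
  \<comment> \<open>The \<open>i\<close>-th basis vector is replaced by the boundary of the \<open>n\<close>-th one, which has leading index \<open>i\<close>.\<close>
  define f where "f k z = (if k = i then r \<otimes> ext_a i z
    else if Some k \<in> range br \<or> dcoeff k = \<zero> then ext_a k z
    else ext_a k z \<oplus> (\<ominus> (dcoeff k \<otimes> r)) \<otimes> ext_a i z)" for k z
  have coeff: "\<ominus> (dcoeff k \<otimes> r) \<in> carrier R" if "k < length xs" for k
    using dcoeff_closed[OF that] r by simp
  have f_eq: "f k = ext_a k" if "k \<noteq> i" "Some k \<in> range br \<or> dcoeff k = \<zero>" for k
    using that by (auto simp: f_def)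
  have n_unpaired: "br j \<noteq> Some n" for j
    using br_less[of j n] by auto
  have "reduction R xs deg D (Suc n) f (br(n \<mapsto> i))"
  proof unfold_locales
    show "Suc n \<le> length xs"
      using n by simp
    show "functional R (set xs) (f k)" if k: "k < length xs" for k
      using functional_scale[OF functional_ext_a[OF i(1)] r(1)] functional_ext_a[OF k]
        functional_comb[OF functional_ext_a[OF k] functional_ext_a[OF i(1)] coeff[OF k]]
      by (cases "k = i"; cases "Some k \<in> range br \<or> dcoeff k = \<zero>") (simp_all add: f_def[abs_def])
    show "\<exists>u\<in>carrier R - {\<zero>}. \<forall>z\<in>V.
      (\<forall>l<length xs. k < l \<and> deg (xs ! l) = deg (xs ! k) \<longrightarrow> z (xs ! l) = \<zero>) \<longrightarrow>
      f k z = u \<otimes> z (xs ! k)" if k: "k < length xs" for k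
    proof -
      obtain u where u: "u \<in> carrier R - {\<zero>}"
        "\<And>z. \<lbrakk>z \<in> V; \<forall>l < length xs. k < l \<and> deg (xs ! l) = deg (xs ! k) \<longrightarrow> z (xs ! l) = \<zero>\<rbrakk> \<Longrightarrow>
          ext_a k z = u \<otimes> z (xs ! k)"
        using ext_a_triangular[OF k] by blast
      consider "k = i" | "k \<noteq> i" "Some k \<in> range br \<or> dcoeff k = \<zero>"
        | "k < i" "Some k \<notin> range br" "dcoeff k \<noteq> \<zero>"
        using max[OF k] by force
      then show ?thesis
      proof cases
        case 1
        have "r \<otimes> u \<in> carrier R - {\<zero>}"
          using r u integral by auto
        moreover have "r \<otimes> (u \<otimes> z (xs ! k)) = r \<otimes> u \<otimes> z (xs ! k)" if "z \<in> V" for z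
          using r u fun_space_closed[OF that] by (simp add: m_assoc)
        ultimately show ?thesis
          using u 1 by (intro bexI[of _ "r \<otimes> u"]) (auto simp: f_def)
      next
        case 2
        then show ?thesis
          using f_eq u by auto
      next
        case 3
        \<comment> \<open>Both indices occur in the boundary of the same simplex and so share a
          degree. The assumption on the positions after \<open>k\<close> therefore covers everything
          that \<open>ext_a i\<close> looks at.\<close>
        have deg_k: "deg (xs ! k) = deg (xs ! i)"
          using dcoeff_deg[OF k 3(3)] deg_i by simp
        obtain v where v: "v \<in> carrier R - {\<zero>}"
          "\<And>z. \<lbrakk>z \<in> V; \<forall>l < length xs. i < l \<and> deg (xs ! l) = deg (xs ! i) \<longrightarrow> z (xs ! l) = \<zero>\<rbrakk> \<Longrightarrow>
            ext_a i z = v \<otimes> z (xs ! i)"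
          using ext_a_triangular[OF i(1)] by blast
        have "f k z = u \<otimes> z (xs ! k)"
          if z: "z \<in> V" "\<forall>l < length xs. k < l \<and> deg (xs ! l) = deg (xs ! k) \<longrightarrow> z (xs ! l) = \<zero>"
          for z
        proof -
          have "ext_a i z = \<zero>"
            using v z 3(1) deg_k i(1) by auto
          then show ?thesis
            using 3 u z coeff[OF k] ext_a_closed[OF k z(1)] by (simp add: f_def)
        qed
        then show ?thesis
          using u(1) by blast
      qed
    qed
    show "f k z = z (xs ! k)" if "Suc n \<le> k" "k < length xs" "z \<in> V" for k z
      using that f_eq[of k] dcoeff_ge[of k] i_less ext_a_ge by simp
    show "f k z = \<zero>" if k: "k < Suc n" and z: "z \<in> V" "\<And>l. l < Suc n \<Longrightarrow> z (xs ! l) = \<zero>" for k z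
    proof -
      have "ext_a k z = \<zero>" "ext_a i z = \<zero>"
        using ext_a_less k z i_less by auto
      then show ?thesis
        using r coeff[of k] k n by (simp add: f_def)
    qed
    show "k < j \<and> j < Suc n" if "(br(n \<mapsto> i)) j = Some k" for j k
      using that br_less[of j k] i_less by (auto split: if_splits)
    show "deg (xs ! j) = Suc (deg (xs ! k))" if "(br(n \<mapsto> i)) j = Some k" for j k
      using that br_deg[of j k] deg_i by (auto split: if_splits)
    show "j = j'" if "(br(n \<mapsto> i)) j = Some k" "(br(n \<mapsto> i)) j' = Some k" for j j' k
      using that br_inj[of j k j'] i(2) by (auto split: if_splits) (metis rangeI)+
    show "f k (D z) = f j z" if jk: "(br(n \<mapsto> i)) j = Some k" and z: "z \<in> V_upto (Suc n)" for j k z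
    proof (cases "j = n")
      case True
      have t: "z (xs ! n) \<in> carrier R"
        using z by (rule fun_space_closed)
      have "f k (D z) = r \<otimes> (z (xs ! n) \<otimes> dcoeff i)"
        using True jk ext_a_D_unpaired[OF i(1,2) z] by (simp add: f_def)
      also have "\<dots> = z (xs ! n)"
        using r t dcoeff_closed[OF i(1)] m_lcomm[of r "z (xs ! n)" "dcoeff i"] by simp
      also have "\<dots> = f j z"
        using True f_eq[of n] dcoeff_ge[of n] n i_less ext_a_ge[OF _ n V_upto_V[OF z]] by simp
      finally show ?thesis .
    next
      case False
      then have jk': "br j = Some k"
        using jk by simp
      \<comment> \<open>Old pairs are undisturbed: \<open>i\<close> was unmatched, so it differs
        from \<open>k\<close>; and \<open>dcoeff\<close> vanishes at death indices, so
        \<open>j\<close> differs from \<open>i\<close> and its coordinate receives no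
        correction.\<close>
      then have "k \<noteq> i" "Some k \<in> range br" "j \<noteq> i"
        using i(2,3) dcoeff_death[OF jk'] by (metis rangeI)+
      then show ?thesis
        using f_eq[of k] f_eq[of j] dcoeff_death[OF jk'] ext_a_D_paired[OF jk' z] by simp
    qed
    show "f k (D z) = \<zero>" if k: "k < length xs" "Some k \<notin> range (br(n \<mapsto> i))"
      and z: "z \<in> V_upto (Suc n)" for k z
    proof -
      have "k \<noteq> i"
        using k(2) by (metis fun_upd_same rangeI)
      have k': "Some k \<notin> range br"
      proof
        assume "Some k \<in> range br"
        then obtain j where j: "br j = Some k"
          by (metis imageE)
        then have "j \<noteq> n"
          using br_less by blast
        then show False
          using k(2) j by (metis fun_upd_other rangeI)
      qed
      have t: "z (xs ! n) \<in> carrier R"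
        using z by (rule fun_space_closed)
      have c: "dcoeff k \<in> carrier R" "dcoeff i \<in> carrier R"
        using dcoeff_closed k i by auto
      \<comment> \<open>As \<open>r\<close> inverts \<open>dcoeff i\<close>, the multiple of
        coordinate \<open>i\<close> taken away from coordinate \<open>k\<close> is exactly what the
        new simplex contributes there.\<close>
      have "dcoeff k \<otimes> r \<otimes> (z (xs ! n) \<otimes> dcoeff i) = z (xs ! n) \<otimes> dcoeff k \<otimes> (r \<otimes> dcoeff i)"
        using c t r(1) by (simp add: m_ac)
      then have "\<ominus> (dcoeff k \<otimes> r) \<otimes> (z (xs ! n) \<otimes> dcoeff i) = \<ominus> (z (xs ! n) \<otimes> dcoeff k)"
        using c t r(1,2) l_minus[of "dcoeff k \<otimes> r" "z (xs ! n) \<otimes> dcoeff i"] by simp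
      then show ?thesis
        using \<open>k \<noteq> i\<close> k' ext_a_D_unpaired[OF k(1) k' z] ext_a_D_unpaired[OF i(1,2) z] c t
        by (auto simp: f_def r_neg)
    qed
  qed
  then show ?thesis
    by blast
qed

lemma reduction_Suc: "\<exists>f br'. reduction R xs deg D (Suc n) f br'"
proof (cases "\<exists>k < length xs. Some k \<notin> range br \<and> dcoeff k \<noteq> \<zero>")
  case False
  then show ?thesis
    using reduction_Suc_birth by blast
next
  case True
  let ?A = "{k. k < length xs \<and> Some k \<notin> range br \<and> dcoeff k \<noteq> \<zero>}"
  have fin: "finite ?A" and "?A \<noteq> {}"
    using True by auto
  then have "Max ?A \<in> ?A" "\<And>k. k \<in> ?A \<Longrightarrow> k \<le> Max ?A"
    by (auto intro: Max_in Max_ge simp del: mem_Collect_eq)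
  then show ?thesis
    using reduction_Suc_death[of "Max ?A"] by blast
qed

end

end

lemma (in filtered_complex) reduction_exists:
  "n \<le> length xs \<Longrightarrow> \<exists>a br. reduction R xs deg D n a br"
proof (induction n)
  case 0
  then show ?case
    using reduction_0 by blast
next
  case (Suc n)
  then show ?case
    using reduction.reduction_Suc by (metis Suc_leD Suc_le_lessD)
qed

section \<open>Fully reduced coordinates\<close>

locale full_reduction = reduction R xs deg D "length xs" a br
  for R :: "('k, 'm) ring_scheme" (structure) and xs :: "'x list" and deg D a br
begin

definition C :: "nat \<Rightarrow> nat \<Rightarrow> ('x \<Rightarrow> 'k) set" where
  "C n d = fun_space R {x \<in> set (take n xs). deg x = d}"

lemma C_V_upto: "z \<in> C n d \<Longrightarrow> z \<in> V_upto n"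
  using fun_space_mono[of "{x \<in> set (take n xs). deg x = d}" "set (take n xs)" R]
  by (auto simp: C_def)

lemma C_V: "z \<in> C n d \<Longrightarrow> z \<in> V"
  using C_V_upto V_upto_V by blast

lemma C_mono: "n \<le> n' \<Longrightarrow> C n d \<subseteq> C n' d"
  unfolding C_def using set_take_subset_set_take[of n n' xs] by (intro fun_space_mono) auto

lemma C_other_deg: "\<lbrakk>z \<in> C n d; deg x \<noteq> d\<rbrakk> \<Longrightarrow> z x = \<zero>"
  unfolding C_def by (erule fun_space_outside) simp

lemma C_I: "\<lbrakk>z \<in> V_upto n; \<And>x. deg x \<noteq> d \<Longrightarrow> z x = \<zero>\<rbrakk> \<Longrightarrow> z \<in> C n d"
  by (auto simp: C_def fun_space_def)

lemma D_C:
  assumes "z \<in> C n (Suc d)"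
  shows "D z \<in> C n d"
proof (rule C_I)
  show "D z \<in> V_upto n"
    by (rule D_V_upto[OF C_V_upto[OF assms]])
  show "D z x = \<zero>" if "deg x \<noteq> d" for x
    using that by (intro D_deg C_V[OF assms] C_other_deg[OF assms]) simp
qed

lemma unit_chain_C: "n < length xs \<Longrightarrow> unit_chain n \<in> C (Suc n) (deg (xs ! n))"
  by (intro C_I unit_chain_V_upto) (auto simp: unit_chain_def)

text \<open>At the last nonzero position triangularity reduces the coordinate to a nonzero scalar
  times the coefficient.\<close>

lemma a_leading:
  assumes "k < length xs" "z \<in> V" "z (xs ! k) \<noteq> \<zero>"
    and "\<And>l. \<lbrakk>k < l; l < length xs\<rbrakk> \<Longrightarrow> z (xs ! l) = \<zero>"
  shows "a k z \<noteq> \<zero>"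
proof -
  obtain u where "u \<in> carrier R - {\<zero>}" "a k z = u \<otimes> z (xs ! k)"
    using triangular[OF assms(1)] assms(2,4) by meson
  then show ?thesis
    using assms(3) fun_space_closed[OF assms(2)] integral by auto
qed

lemma exists_leading:
  assumes "z \<in> V" "z \<noteq> (\<lambda>x. \<zero>)"
  obtains q where "q < length xs" "z (xs ! q) \<noteq> \<zero>"
    "\<And>l. \<lbrakk>q < l; l < length xs\<rbrakk> \<Longrightarrow> z (xs ! l) = \<zero>"
proof -
  let ?A = "{q. q < length xs \<and> z (xs ! q) \<noteq> \<zero>}"
  have "?A \<noteq> {}"
    using V_eqI[OF assms(1) fun_space_zero] assms(2) by auto
  then have "Max ?A \<in> ?A" "\<And>l. l \<in> ?A \<Longrightarrow> l \<le> Max ?A"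
    by (auto intro: Max_in Max_ge simp del: mem_Collect_eq)
  then show ?thesis
    by (intro that[of "Max ?A"]) (blast, blast, metis (mono_tags) mem_Collect_eq not_le)
qed

text \<open>Injectivity of a triangular system: a nonzero chain has a last nonzero coefficient, and
  the coordinate at that position is nonzero.\<close>

lemma a_eq_zeroD:
  assumes "z \<in> V" "\<And>k. k < length xs \<Longrightarrow> a k z = \<zero>"
  shows "z = (\<lambda>x. \<zero>)"
  using exists_leading[OF assms(1)] a_leading[OF _ assms(1)] assms(2) by metis

lemma a_diff:
  assumes "k < length xs" "z \<in> V" "z' \<in> V"
  shows "a k (\<lambda>x. z x \<oplus> (\<ominus> \<one>) \<otimes> z' x) = a k z \<ominus> a k z'"
  using functional_add[OF functional_a[OF assms(1)] assms(2) fun_space_smult[of "\<ominus> \<one>", OF _ assms(3)]]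
    functional_smult[OF functional_a[OF assms(1)] _ assms(3), of "\<ominus> \<one>"] a_closed[OF assms(1)] assms(2,3)
  by (simp add: minus_eq l_minus)

lemma a_eqI:
  assumes z: "z \<in> V" "z' \<in> V" and eq: "\<And>k. k < length xs \<Longrightarrow> a k z = a k z'"
  shows "z = z'"
proof -
  let ?y = "\<lambda>x. z x \<oplus> (\<ominus> \<one>) \<otimes> z' x"
  have y: "?y \<in> V"
    using z by (intro fun_space_add fun_space_smult) auto
  have "a k ?y = \<zero>" if "k < length xs" for k
    using a_diff[OF that z] eq[OF that] a_closed[OF that z(2)] by (simp add: minus_eq r_neg)
  then have "?y = (\<lambda>x. \<zero>)"
    by (rule a_eq_zeroD[OF y])
  then have "z x \<ominus> z' x = \<zero>" for x
    using fun_space_closed[OF z(2)] by (simp add: minus_eq l_minus fun_eq_iff)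
  then show ?thesis
    using fun_space_closed[OF z(1)] fun_space_closed[OF z(2)] by (auto simp: fun_eq_iff)
qed

lemma a_V_upto: "\<lbrakk>z \<in> V_upto n; n \<le> k; k < length xs\<rbrakk> \<Longrightarrow> a k z = \<zero>"
  by (rule a_vanish) (auto intro: V_upto_V V_upto_nth)

lemma a_C: "\<lbrakk>z \<in> C n d; k < length xs; deg (xs ! k) \<noteq> d\<rbrakk> \<Longrightarrow> a k z = \<zero>"
  by (rule a_vanish) (auto intro: C_V C_other_deg)

text \<open>Back substitution in a triangular system: the last coordinate fixes the multiple of the
  last simplex, and the induction hypothesis repairs the earlier ones. The solution stays in stage
  \<open>n\<close> and in degree \<open>d\<close>. Applied to an indicator function, this produces
  the basis vectors.\<close>

lemma a_surj:
  assumes "n \<le> length xs"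
    and "\<And>k. k < n \<Longrightarrow> f k \<in> carrier R"
    and "\<And>k. \<lbrakk>k < n; deg (xs ! k) \<noteq> d\<rbrakk> \<Longrightarrow> f k = \<zero>"
  shows "\<exists>z \<in> C n d. \<forall>k < n. a k z = f k"
  using assms
proof (induction n arbitrary: f)
  case 0
  then show ?case
    using fun_space_zero[of "{x \<in> set (take 0 xs). deg x = d}"] by (auto simp: C_def)
next
  case (Suc n)
  have n: "n < length xs"
    using Suc.prems(1) by simp
  have u: "unit_chain n \<in> V"
    by (rule unit_chain_V[OF n])
  have "unit_chain n (xs ! l) = \<zero>" if "l < length xs" "n < l" for l
    using unit_chain_nth n that by simp
  then obtain v where v: "v \<in> carrier R - {\<zero>}" "a n (unit_chain n) = v \<otimes> unit_chain n (xs ! n)"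
    using triangular[OF n] u by meson
  then have v': "a n (unit_chain n) = v"
    using unit_chain_nth[OF n n] by simp
  \<comment> \<open>Here \<open>v\<close> is the diagonal entry at \<open>n\<close>; the remaining
    summand will lie in \<open>V_upto n\<close> and leave coordinate \<open>n\<close>
    untouched.\<close>
  define s where "s = f n \<otimes> inv v"
  have v_inv: "inv v \<in> carrier R" "inv v \<otimes> v = \<one>"
    using v field_Units by auto
  have fn: "f n \<in> carrier R"
    using Suc.prems(2) by simp
  have s: "s \<in> carrier R" "s \<otimes> v = f n"
    using v v_inv fn by (auto simp: s_def m_assoc)
  have s_deg: "s = \<zero>" if "deg (xs ! n) \<noteq> d"
    using Suc.prems(3)[of n] that v_inv by (simp add: s_def)
  let ?f = "\<lambda>k. f k \<ominus> s \<otimes> a k (unit_chain n)"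
  have cl: "a k (unit_chain n) \<in> carrier R" if "k < n" for k
    using that n by (intro a_closed u) auto
  have "\<exists>z \<in> C n d. \<forall>k < n. a k z = ?f k"
  proof (rule Suc.IH)
    show "n \<le> length xs"
      using n by simp
    show "?f k \<in> carrier R" if "k < n" for k
      using that cl s Suc.prems(2) by simp
    show "?f k = \<zero>" if k: "k < n" "deg (xs ! k) \<noteq> d" for k
    proof -
      have "s \<otimes> a k (unit_chain n) = \<zero>"
        using s_deg s cl[OF k(1)] a_C[OF unit_chain_C[OF n], of k] k n by (cases "deg (xs ! n) = d") auto
      then show ?thesis
        using Suc.prems(3)[of k] k by (simp add: minus_eq)
    qed
  qed
  then obtain z where z: "z \<in> C n d" "\<And>k. k < n \<Longrightarrow> a k z = ?f k"
    by blast
  let ?z = "\<lambda>x. z x \<oplus> s \<otimes> unit_chain n x"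
  have a_z: "a k ?z = a k z \<oplus> s \<otimes> a k (unit_chain n)" if k: "k < length xs" for k
    using functional_add[OF functional_a[OF k] C_V[OF z(1)] fun_space_smult[OF s(1) u]]
      functional_smult[OF functional_a[OF k] s(1) u] by simp
  have "?z \<in> C (Suc n) d"
  proof (rule C_I)
    show "?z \<in> V_upto (Suc n)"
      using C_V_upto[OF z(1)] V_upto_mono s unit_chain_V_upto[OF n]
      by (intro fun_space_add fun_space_smult) auto
    show "?z x = \<zero>" if "deg x \<noteq> d" for x
      using C_other_deg[OF z(1) that] s s_deg that by (auto simp: unit_chain_def)
  qed
  moreover have "a k ?z = f k" if k: "k < Suc n" for k
  proof (cases "k = n")
    case True
    then show ?thesis
      using a_z[OF n] a_V_upto[OF C_V_upto[OF z(1)] order.refl n] v' s fn by simp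
  next
    case False
    then have "k < n"
      using k by simp
    then show ?thesis
      using a_z[of k] z(2)[of k] n cl[of k] Suc.prems(2)[of k] s(1) by (simp add: minus_eq a_assoc l_neg)
  qed
  ultimately show ?case
    by blast
qed

text \<open>Each coordinate of \<open>D z\<close> is either zero or a coordinate of \<open>z\<close>
  at a death index, and the coordinates together separate chains.\<close>

lemma cycle_iff:
  assumes "z \<in> V"
  shows "D z = (\<lambda>x. \<zero>) \<longleftrightarrow> (\<forall>j k. br j = Some k \<longrightarrow> a j z = \<zero>)"
proof
  assume D: "D z = (\<lambda>x. \<zero>)"
  show "\<forall>j k. br j = Some k \<longrightarrow> a j z = \<zero>"
    using a_D_paired[of _ _ z] a_zero br_less assms D by (metis V_upto_length order.strict_trans)
next
  assume *: "\<forall>j k. br j = Some k \<longrightarrow> a j z = \<zero>"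
  show "D z = (\<lambda>x. \<zero>)"
  proof (rule a_eq_zeroD[OF D_V[OF assms]])
    fix k
    assume k: "k < length xs"
    show "a k (D z) = \<zero>"
      using a_D_unpaired[OF k, of z] a_D_paired[of _ k z] * assms by (metis V_upto_length imageE)
  qed
qed

text \<open>For the converse a preimage is prescribed by its coordinates: at a death index
  \<open>j < n\<close> it copies the coordinate of \<open>z\<close> at the matched birth index. That
  such a chain exists already in \<open>C n (Suc d)\<close> is what makes the criterion valid stage
  by stage.\<close>

lemma boundary_iff:
  assumes n: "n \<le> length xs" and z: "z \<in> C n d"
  shows "z \<in> D ` C n (Suc d) \<longleftrightarrow>
    (\<forall>k < length xs. (\<forall>j < n. br j \<noteq> Some k) \<longrightarrow> a k z = \<zero>)"
proof
  assume "z \<in> D ` C n (Suc d)"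
  then obtain w where w: "w \<in> C n (Suc d)" "z = D w"
    by blast
  have w': "w \<in> V_upto (length xs)"
    using C_V[OF w(1)] by simp
  show "\<forall>k < length xs. (\<forall>j < n. br j \<noteq> Some k) \<longrightarrow> a k z = \<zero>"
  proof (intro allI impI)
    fix k
    assume k: "k < length xs" and no: "\<forall>j < n. br j \<noteq> Some k"
    show "a k z = \<zero>"
    proof (cases "Some k \<in> range br")
      case True
      then obtain j where j: "br j = Some k"
        by (metis imageE)
      then have "n \<le> j" "j < length xs"
        using no br_less[OF j] by (auto simp: not_le[symmetric])
      then show ?thesis
        using a_D_paired[OF j w'] a_V_upto[OF C_V_upto[OF w(1)]] w(2) by simp
    next
      case False
      then show ?thesis
        using a_D_unpaired[OF k _ w'] w(2) by simp
    qed
  qed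
next
  assume *: "\<forall>k < length xs. (\<forall>j < n. br j \<noteq> Some k) \<longrightarrow> a k z = \<zero>"
  define f where "f j = (case br j of None \<Rightarrow> \<zero> | Some k \<Rightarrow> a k z)" for j
  have "\<exists>w \<in> C n (Suc d). \<forall>j < n. a j w = f j"
  proof (rule a_surj[OF n])
    show "f j \<in> carrier R" for j
      using a_closed[OF _ C_V[OF z]] br_less[of j] by (auto simp: f_def split: option.split)
    show "f j = \<zero>" if "deg (xs ! j) \<noteq> Suc d" for j
      using a_C[OF z] br_less[of j] br_deg[of j] that by (force simp: f_def split: option.split)
  qed
  then obtain w where w: "w \<in> C n (Suc d)" "\<And>j. j < n \<Longrightarrow> a j w = f j"
    by blast
  have w': "w \<in> V_upto (length xs)"
    using C_V[OF w(1)] by simp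
  have "D w = z"
  proof (rule a_eqI)
    show "D w \<in> V" "z \<in> V"
      using D_V C_V w(1) z by blast+
    fix k
    assume k: "k < length xs"
    show "a k (D w) = a k z"
    proof (cases "Some k \<in> range br")
      case True
      then obtain j where j: "br j = Some k"
        by (metis imageE)
      show ?thesis
      proof (cases "j < n")
        case True
        then show ?thesis
          using a_D_paired[OF j w'] w(2) j by (simp add: f_def)
      next
        case False
        \<comment> \<open>By injectivity \<open>k\<close> has no other partner, so the assumption
          makes the coordinate of \<open>z\<close> zero; the one of \<open>w\<close> is zero because
          \<open>w\<close> lives on the first \<open>n\<close> simplices.\<close>
        then have "\<forall>j' < n. br j' \<noteq> Some k"
          using br_inj[OF j] by blast
        then show ?thesis
          using a_D_paired[OF j w'] a_V_upto[OF C_V_upto[OF w(1)]] False br_less[OF j] * k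
          by simp
      qed
    next
      case False
      then show ?thesis
        using a_D_unpaired[OF k False w'] * k by (metis rangeI)
    qed
  qed
  then show "z \<in> D ` C n (Suc d)"
    using w(1) by blast
qed

text \<open>The three conditions on the basis vector \<open>k\<close>: it is present at stage
  \<open>n\<close>, it is a cycle, and it is not yet a boundary at that stage.\<close>

definition alive :: "nat \<Rightarrow> nat \<Rightarrow> bool" where
  "alive n k \<longleftrightarrow> k < n \<and> br k = None \<and> (\<forall>j < n. br j \<noteq> Some k)"

text \<open>The remaining coordinates tested by \<open>boundary_iff\<close> vanish on every such
  cycle: by the filtration, by the cycle condition, or by degree. So the living coordinates are
  injective on homology.\<close>

lemma cycle_boundary_iff:
  assumes n: "n \<le> length xs" and z: "z \<in> C n d" "D z = (\<lambda>x. \<zero>)"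
  shows "z \<in> D ` C n (Suc d) \<longleftrightarrow> (\<forall>k. alive n k \<and> deg (xs ! k) = d \<longrightarrow> a k z = \<zero>)"
proof -
  have "a k z = \<zero>" if k: "k < length xs" "\<forall>j < n. br j \<noteq> Some k" "\<not> (alive n k \<and> deg (xs ! k) = d)" for k
  proof -
    consider "n \<le> k" | "br k \<noteq> None" | "deg (xs ! k) \<noteq> d"
      using k by (auto simp: alive_def)
    then show ?thesis
    proof cases
      case 1
      then show ?thesis
        using a_V_upto[OF C_V_upto[OF z(1)]] k(1) by blast
    next
      case 2
      then show ?thesis
        using cycle_iff[OF C_V[OF z(1)]] z(2) by blast
    next
      case 3
      then show ?thesis
        using a_C[OF z(1)] k(1) by blast
    qed
  qed
  moreover have "k < length xs \<and> (\<forall>j < n. br j \<noteq> Some k)" if "alive n k" for k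
    using that n by (simp add: alive_def)
  ultimately show ?thesis
    unfolding boundary_iff[OF n z(1)] by blast
qed

text \<open>Setting all other coordinates to zero yields a cycle, since a death index is never
  alive. So the living coordinates are also surjective on homology.\<close>

lemma cycle_surj:
  assumes n: "n \<le> length xs" and f: "\<And>k. f k \<in> carrier R"
  shows "\<exists>z \<in> C n d. D z = (\<lambda>x. \<zero>) \<and> (\<forall>k. alive n k \<and> deg (xs ! k) = d \<longrightarrow> a k z = f k)"
proof -
  let ?f = "\<lambda>k. if alive n k \<and> deg (xs ! k) = d then f k else \<zero>"
  have "\<exists>z \<in> C n d. \<forall>k < n. a k z = ?f k"
    by (rule a_surj[OF n]) (use f in auto)
  then obtain z where z: "z \<in> C n d" "\<And>k. k < n \<Longrightarrow> a k z = ?f k"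
    by blast
  have "a j z = \<zero>" if "br j = Some k" for j k
  proof (cases "j < n")
    case True
    then show ?thesis
      using z(2) that by (simp add: alive_def)
  next
    case False
    then show ?thesis
      using a_V_upto[OF C_V_upto[OF z(1)]] br_less[OF that] by simp
  qed
  then have "D z = (\<lambda>x. \<zero>)"
    using cycle_iff[OF C_V[OF z(1)]] by blast
  moreover have "a k z = f k" if "alive n k" "deg (xs ! k) = d" for k
    using z(2)[of k] that by (simp add: alive_def)
  ultimately show ?thesis
    using z(1) by blast
qed

lemma apparent_paired:
  assumes i: "i < length xs" and j: "j < length xs"
    and lead: "D (unit_chain j) (xs ! i) \<noteq> \<zero>"
      "\<And>l. \<lbrakk>i < l; l < length xs\<rbrakk> \<Longrightarrow> D (unit_chain j) (xs ! l) = \<zero>"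
    and first: "\<And>z. z \<in> V_upto j \<Longrightarrow> D z (xs ! i) = \<zero>"
  shows "br j = Some i"
proof -
  let ?u = "unit_chain j"
  have u: "?u \<in> V" "?u \<in> V_upto (length xs)"
    using unit_chain_V[OF j] by simp_all
  have ne: "a i (D ?u) \<noteq> \<zero>"
    using a_leading[OF i D_V[OF u(1)]] lead by blast
  then obtain q where q: "br q = Some i"
    using a_D_unpaired[OF i _ u(2)] by (metis imageE)
  have "a q ?u \<noteq> \<zero>"
    using a_D_paired[OF q u(2)] ne by simp
  then have "q \<le> j"
    using a_V_upto[OF unit_chain_V_upto[OF j], of q] br_less[OF q] by force
  moreover have "\<not> q < j"
  proof
    assume "q < j"
    have q': "Suc q \<le> length xs"
      using br_less[OF q] by simp
    \<comment> \<open>This \<open>z\<close> is the basis vector of index \<open>q\<close>; its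
      boundary is the basis vector of index \<open>i\<close>.\<close>
    obtain z where z: "z \<in> C (Suc q) (deg (xs ! q))"
      "\<And>k. k < Suc q \<Longrightarrow> a k z = (if k = q then \<one> else \<zero>)"
      using a_surj[OF q', of "\<lambda>k. if k = q then \<one> else \<zero>" "deg (xs ! q)"] by fastforce
    have z': "z \<in> V_upto (length xs)"
      using C_V[OF z(1)] by simp
    have a_z: "a k z = (if k = q then \<one> else \<zero>)" if "k < length xs" for k
      using z(2) a_V_upto[OF C_V_upto[OF z(1)] _ that] by (cases "k < Suc q") auto
    have a_Dz: "a k (D z) = (if k = i then \<one> else \<zero>)" if k: "k < length xs" for k
    proof (cases "Some k \<in> range br")
      case True
      then obtain l where l: "br l = Some k"
        by (metis imageE)
      then have "l = q \<longleftrightarrow> k = i"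
        using q l br_inj by (metis option.inject)
      then show ?thesis
        using a_D_paired[OF l z'] a_z[of l] br_less[OF l] by simp
    next
      case False
      then show ?thesis
        using a_D_unpaired[OF k False z'] q by (metis rangeI)
    qed
    have "D z \<noteq> (\<lambda>x. \<zero>)"
      using a_Dz[OF i] a_zero[OF i] by auto
    then obtain r where r: "r < length xs" "D z (xs ! r) \<noteq> \<zero>"
      "\<And>l. \<lbrakk>r < l; l < length xs\<rbrakk> \<Longrightarrow> D z (xs ! l) = \<zero>"
      using exists_leading[OF D_V[OF C_V[OF z(1)]]] by blast
    \<comment> \<open>A leading position carries a nonzero coordinate, and \<open>i\<close> is the
      only index with one. Hence the simplex \<open>xs ! i\<close> itself, and not merely the
      coordinate of index \<open>i\<close>, occurs in the boundary of \<open>z\<close>.\<close>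
    then have "r = i"
      using a_leading[OF r(1) D_V[OF C_V[OF z(1)]]] a_Dz[OF r(1)] by metis
    moreover have "z \<in> V_upto j"
      using V_upto_mono[OF C_V_upto[OF z(1)]] \<open>q < j\<close> by simp
    ultimately show False
      using first r(2) by blast
  qed
  ultimately show ?thesis
    using q by simp
qed

end

section \<open>Uniqueness of barcodes\<close>

definition interval_sum :: "'k ring \<Rightarrow> nat set list \<Rightarrow> ('k, nat \<Rightarrow> 'k) pmod" where
  "interval_sum F Js = pmod_sum (length Js) (\<lambda>k. interval_module F (Js ! k))"

lemma carrier_interval_sum: "carrier (sp (interval_sum F Js) i) =
    (\<Pi>\<^sub>E k \<in> {..<length Js}. if i \<in> Js ! k then carrier F else {\<zero>\<^bsub>F\<^esub>})"
  by (simp add: interval_sum_def pmod_sum_def interval_module_def)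

lemma tr_interval_sum: "tr (interval_sum F Js) i j x =
    (\<lambda>k\<in>{..<length Js}. if i \<in> Js ! k \<and> j \<in> Js ! k then x k else \<zero>\<^bsub>F\<^esub>)"
  by (simp add: interval_sum_def pmod_sum_def interval_module_def)

lemma zero_interval_sum: "\<zero>\<^bsub>sp (interval_sum F Js) i\<^esub> = (\<lambda>k\<in>{..<length Js}. \<zero>\<^bsub>F\<^esub>)"
  by (simp add: interval_sum_def pmod_sum_def interval_module_def)

lemma add_interval_sum:
  "x \<oplus>\<^bsub>sp (interval_sum F Js) i\<^esub> y = (\<lambda>k\<in>{..<length Js}. x k \<oplus>\<^bsub>F\<^esub> y k)"
  by (simp add: interval_sum_def pmod_sum_def interval_module_def)

lemma smult_interval_sum:
  "s \<odot>\<^bsub>sp (interval_sum F Js) i\<^esub> x = (\<lambda>k\<in>{..<length Js}. s \<otimes>\<^bsub>F\<^esub> x k)"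
  by (simp add: interval_sum_def pmod_sum_def interval_module_def)

lemma tr_image_interval_sum:
  assumes "\<zero>\<^bsub>F\<^esub> \<in> carrier F"
  shows "tr (interval_sum F Js) i j ` carrier (sp (interval_sum F Js) i) =
    (\<Pi>\<^sub>E k \<in> {..<length Js}. if i \<in> Js ! k \<and> j \<in> Js ! k then carrier F else {\<zero>\<^bsub>F\<^esub>})"
  (is "?L = ?R")
proof
  show "?L \<subseteq> ?R"
  proof (rule image_subsetI)
    fix x
    assume "x \<in> carrier (sp (interval_sum F Js) i)"
    then have "x k \<in> (if i \<in> Js ! k then carrier F else {\<zero>\<^bsub>F\<^esub>})" if "k < length Js" for k
      using that by (auto simp only: carrier_interval_sum dest: PiE_mem)
    then show "tr (interval_sum F Js) i j x \<in> ?R"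
      unfolding tr_interval_sum restrict_PiE_iff by (metis lessThan_iff singletonI)
  qed
  show "?R \<subseteq> ?L"
  proof
    fix y
    assume y: "y \<in> ?R"
    have mem: "y k \<in> (if i \<in> Js ! k \<and> j \<in> Js ! k then carrier F else {\<zero>\<^bsub>F\<^esub>})" if "k < length Js" for k
      using PiE_mem[OF y, of k] that by simp
    \<comment> \<open>An element of the right-hand side is supported on intervals containing both
      indices, so it is its own preimage.\<close>
    have "y = tr (interval_sum F Js) i j y"
    proof (rule extensionalityI)
      show "y \<in> extensional {..<length Js}"
        using y by (simp add: PiE_iff)
      show "y k = tr (interval_sum F Js) i j y k" if "k \<in> {..<length Js}" for k
        using mem[of k] that by (simp add: tr_interval_sum split: if_splits)
    qed (simp add: tr_interval_sum)
    moreover have "y \<in> carrier (sp (interval_sum F Js) i)"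
      unfolding carrier_interval_sum
    proof (rule PiE_I)
      show "y k \<in> (if i \<in> Js ! k then carrier F else {\<zero>\<^bsub>F\<^esub>})" if "k \<in> {..<length Js}" for k
        using mem[of k] that assms by (simp split: if_splits)
      show "y k = undefined" if "k \<notin> {..<length Js}" for k
        using PiE_arb[OF y that] .
    qed
    ultimately show "y \<in> ?L"
      by blast
  qed
qed

lemma card_tr_image_interval_sum:
  assumes "\<zero>\<^bsub>F\<^esub> \<in> carrier F"
  shows "card (tr (interval_sum F Js) i j ` carrier (sp (interval_sum F Js) i)) =
    card (carrier F) ^ size (filter_mset (\<lambda>J. i \<in> J \<and> j \<in> J) (mset Js))"
proof -
  have "card (tr (interval_sum F Js) i j ` carrier (sp (interval_sum F Js) i)) =
      (\<Prod>k<length Js. if i \<in> Js ! k \<and> j \<in> Js ! k then card (carrier F) else 1)"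
    unfolding tr_image_interval_sum[OF assms] by (subst card_PiE) (auto intro!: prod.cong)
  also have "\<dots> = card (carrier F) ^ card {k. k < length Js \<and> i \<in> Js ! k \<and> j \<in> Js ! k}"
    by (simp add: prod.If_cases Int_def)
  also have "card {k. k < length Js \<and> i \<in> Js ! k \<and> j \<in> Js ! k} =
      size (filter_mset (\<lambda>J. i \<in> J \<and> j \<in> J) (mset Js))"
    by (simp add: length_filter_conv_card flip: mset_filter)
  finally show ?thesis .
qed

lemma pmod_iso_card_image:
  assumes iso: "pmod_iso F m M N" and pm: "persistence_module F m M" and ij: "i \<le> j" "j \<le> m"
  shows "card (tr M i j ` carrier (sp M i)) = card (tr N i j ` carrier (sp N i))"
proof -
  obtain \<phi> where bij: "\<And>i. i \<le> m \<Longrightarrow> bij_betw (\<phi> i) (carrier (sp M i)) (carrier (sp N i))"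
    and comm: "\<And>i j x. \<lbrakk>i \<le> j; j \<le> m; x \<in> carrier (sp M i)\<rbrakk> \<Longrightarrow> \<phi> j (tr M i j x) = tr N i j (\<phi> i x)"
    using iso unfolding pmod_iso_def by blast
  have "linear_map F (sp M i) (sp M j) (tr M i j)"
    using pm ij by (simp add: persistence_module_def)
  then have sub: "tr M i j ` carrier (sp M i) \<subseteq> carrier (sp M j)"
    by (auto simp: linear_map_def mod_hom_def mod_hom_axioms_def module_hom_def)
  have "\<phi> j ` tr M i j ` carrier (sp M i) = tr N i j ` \<phi> i ` carrier (sp M i)"
    using comm[OF ij] by (auto simp: image_image intro!: image_cong)
  also have "\<phi> i ` carrier (sp M i) = carrier (sp N i)"
    using bij ij by (simp add: bij_betw_def)
  finally have "\<phi> j ` tr M i j ` carrier (sp M i) = tr N i j ` carrier (sp N i)" .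
  moreover have "inj_on (\<phi> j) (tr M i j ` carrier (sp M i))"
    using bij[OF ij(2)] sub by (auto simp: bij_betw_def intro: inj_on_subset)
  ultimately show ?thesis
    using card_image by metis
qed

section \<open>Recovering a multiset of intervals from its rank function\<close>

lemma size_filter_split:
  "size (filter_mset P B) = size (filter_mset (\<lambda>x. P x \<and> Q x) B) + size (filter_mset (\<lambda>x. P x \<and> \<not> Q x) B)"
  by (induction B) auto

lemma index_interval_conv:
  assumes "index_interval m J"
  obtains a b where "a \<le> b" "b \<le> m" "J = {a..b}"
proof -
  have sub: "J \<subseteq> {0..m}" and ne: "J \<noteq> {}"
    and conv: "\<And>x y c. \<lbrakk>x \<in> J; y \<in> J; x \<le> c; c \<le> y\<rbrakk> \<Longrightarrow> c \<in> J"
    using assms unfolding index_interval_def by blast+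
  have fin: "finite J"
    using sub finite_subset by blast
  note mem = Min_in[OF fin ne] Max_in[OF fin ne]
  show thesis
  proof
    show "Min J \<le> Max J"
      using Min_le[OF fin mem(2)] .
    show "Max J \<le> m"
      using mem(2) sub by (meson atLeastAtMost_iff subsetD)
    show "J = {Min J..Max J}"
    proof
      show "J \<subseteq> {Min J..Max J}"
        using Min_le[OF fin] Max_ge[OF fin] by (intro subsetI) simp
      show "{Min J..Max J} \<subseteq> J"
        using conv[OF mem] by (intro subsetI) simp
    qed
  qed
qed

text \<open>Inclusion-exclusion on the two neighbours \<open>a - 1\<close> and \<open>b + 1\<close> of the interval.\<close>

lemma count_interval_eq:
  fixes B :: "nat set multiset"
  defines "r \<equiv> \<lambda>i j. int (size (filter_mset (\<lambda>J. i \<in> J \<and> j \<in> J) B))"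
  assumes B: "\<And>J. J \<in># B \<Longrightarrow> index_interval m J" and ab: "a \<le> b" "b \<le> m"
  shows "int (count B {a..b}) = r a b - (if 0 < a then r (a - 1) b else 0)
    - (if b < m then r a (b + 1) else 0) + (if 0 < a \<and> b < m then r (a - 1) (b + 1) else 0)"
proof -
  let ?s = "\<lambda>P. int (size (filter_mset P B))"
  \<comment> \<open>The guards matter at the two ends: for \<open>a = 0\<close> truncated
    subtraction would give \<open>a\<close> again, and for \<open>b = m\<close> the index
    \<open>b + 1\<close> lies outside the range where ranks are compared.\<close>
  let ?L = "\<lambda>J. 0 < a \<and> a - 1 \<in> J" and ?U = "\<lambda>J. b < m \<and> b + 1 \<in> J"
  have cong: "?s P = ?s Q" if "\<And>J. index_interval m J \<Longrightarrow> P J \<longleftrightarrow> Q J" for P Q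
  proof -
    have "filter_mset P B = filter_mset Q B"
      using that B by (intro filter_mset_cong refl) blast
    then show ?thesis
      by simp
  qed
  have conv: "c \<in> J" if "index_interval m J" "x \<in> J" "y \<in> J" "x \<le> c" "c \<le> y" for J x y c
    using that unfolding index_interval_def by blast
  have 1: "int (count B {a..b}) = ?s (\<lambda>J. ((a \<in> J \<and> b \<in> J) \<and> \<not> ?L J) \<and> \<not> ?U J)"
    unfolding count_conv_size_mset
  proof (rule cong)
    fix J
    assume "index_interval m J"
    then obtain x y where "x \<le> y" "y \<le> m" "J = {x..y}"
      by (rule index_interval_conv)
    then show "J = {a..b} \<longleftrightarrow> ((a \<in> J \<and> b \<in> J) \<and> \<not> ?L J) \<and> \<not> ?U J"
      using ab by (auto simp: Icc_eq_Icc)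
  qed
  have 2: "?s (\<lambda>J. (a \<in> J \<and> b \<in> J) \<and> \<not> ?L J) =
      ?s (\<lambda>J. ((a \<in> J \<and> b \<in> J) \<and> \<not> ?L J) \<and> ?U J) + ?s (\<lambda>J. ((a \<in> J \<and> b \<in> J) \<and> \<not> ?L J) \<and> \<not> ?U J)"
    using size_filter_split[of "\<lambda>J. (a \<in> J \<and> b \<in> J) \<and> \<not> ?L J" B ?U] by simp
  have 3: "r a b = ?s (\<lambda>J. (a \<in> J \<and> b \<in> J) \<and> ?L J) + ?s (\<lambda>J. (a \<in> J \<and> b \<in> J) \<and> \<not> ?L J)"
    using size_filter_split[of "\<lambda>J. a \<in> J \<and> b \<in> J" B ?L] by (simp add: r_def)
  have 4: "?s (\<lambda>J. (a \<in> J \<and> b \<in> J) \<and> ?L J) = (if 0 < a then r (a - 1) b else 0)"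
  proof (cases "0 < a")
    case True
    have "?s (\<lambda>J. (a \<in> J \<and> b \<in> J) \<and> ?L J) = ?s (\<lambda>J. a - 1 \<in> J \<and> b \<in> J)"
    proof (rule cong)
      fix J
      assume "index_interval m J"
      then show "(a \<in> J \<and> b \<in> J) \<and> ?L J \<longleftrightarrow> a - 1 \<in> J \<and> b \<in> J"
        using True ab conv[of J "a - 1" b a] by auto
    qed
    then show ?thesis
      using True by (simp add: r_def)
  qed simp
  have 5: "(if b < m then r a (b + 1) else 0) =
      ?s (\<lambda>J. (a \<in> J \<and> ?U J) \<and> ?L J) + ?s (\<lambda>J. (a \<in> J \<and> ?U J) \<and> \<not> ?L J)"
    using size_filter_split[of "\<lambda>J. a \<in> J \<and> ?U J" B ?L]
    by (cases "b < m") (simp_all add: r_def flip: of_nat_add)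
  have 6: "?s (\<lambda>J. (a \<in> J \<and> ?U J) \<and> ?L J) = (if 0 < a \<and> b < m then r (a - 1) (b + 1) else 0)"
  proof (cases "0 < a \<and> b < m")
    case True
    have "?s (\<lambda>J. (a \<in> J \<and> ?U J) \<and> ?L J) = ?s (\<lambda>J. a - 1 \<in> J \<and> b + 1 \<in> J)"
    proof (rule cong)
      fix J
      assume "index_interval m J"
      then show "(a \<in> J \<and> ?U J) \<and> ?L J \<longleftrightarrow> a - 1 \<in> J \<and> b + 1 \<in> J"
        using True ab conv[of J "a - 1" "b + 1" a] by auto
    qed
    then show ?thesis
      using True by (simp add: r_def)
  qed auto
  have 7: "?s (\<lambda>J. (a \<in> J \<and> ?U J) \<and> \<not> ?L J) = ?s (\<lambda>J. ((a \<in> J \<and> b \<in> J) \<and> \<not> ?L J) \<and> ?U J)"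
  proof (rule cong)
    fix J
    assume "index_interval m J"
    then have "b \<in> J" if "a \<in> J" "b + 1 \<in> J"
      using that ab conv[of J a "b + 1" b] by auto
    then show "(a \<in> J \<and> ?U J) \<and> \<not> ?L J \<longleftrightarrow> ((a \<in> J \<and> b \<in> J) \<and> \<not> ?L J) \<and> ?U J"
      by blast
  qed
  show ?thesis
    using 1 2 3 4 5 6 7 by linarith
qed

lemma interval_multiset_eqI:
  assumes "\<And>J. J \<in># B \<Longrightarrow> index_interval m J" "\<And>J. J \<in># B' \<Longrightarrow> index_interval m J"
    and eq: "\<And>i j. \<lbrakk>i \<le> j; j \<le> m\<rbrakk> \<Longrightarrow>
      size (filter_mset (\<lambda>J. i \<in> J \<and> j \<in> J) B) = size (filter_mset (\<lambda>J. i \<in> J \<and> j \<in> J) B')"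
  shows "B = B'"
proof (rule multiset_eqI)
  fix J
  show "count B J = count B' J"
  proof (cases "index_interval m J")
    case True
    then obtain a b where ab: "a \<le> b" "b \<le> m" "J = {a..b}"
      by (rule index_interval_conv)
    note count = count_interval_eq[OF _ ab(1,2)]
    have "int (count B {a..b}) = int (count B' {a..b})"
      unfolding count[of B, OF assms(1), simplified] count[of B', OF assms(2), simplified]
      using ab by (cases "0 < a"; cases "b < m") (simp_all add: eq)
    then show ?thesis
      using ab(3) by simp
  next
    case False
    then show ?thesis
      using assms(1,2) by (metis count_inI)
  qed
qed

text \<open>
  Over a finite field the rank of a structure map is determined by the cardinality of its image.
\<close>

lemma is_barcode_unique:
  fixes F :: "'k ring"
  assumes F: "\<zero>\<^bsub>F\<^esub> \<in> carrier F" "1 < card (carrier F)"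
    and B: "is_barcode F m M B" and B': "is_barcode F m M B'"
  shows "B = B'"
proof -
  have pm: "persistence_module F m M"
    using B by (simp add: is_barcode_def)
  have key: "(\<forall>J. J \<in># B \<longrightarrow> index_interval m J) \<and> (\<forall>i j. i \<le> j \<and> j \<le> m \<longrightarrow>
      card (carrier F) ^ size (filter_mset (\<lambda>J. i \<in> J \<and> j \<in> J) B) = card (tr M i j ` carrier (sp M i)))"
    if "is_barcode F m M B" for B
  proof -
    obtain Js where Js: "mset Js = B" "\<forall>J \<in> set Js. index_interval m J"
      "pmod_iso F m M (interval_sum F Js)"
      using \<open>is_barcode F m M B\<close> by (auto simp: is_barcode_def interval_sum_def)
    then show ?thesis
      using pmod_iso_card_image[OF Js(3) pm] card_tr_image_interval_sum[OF F(1), of Js] by auto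
  qed
  show ?thesis
  proof (rule interval_multiset_eqI)
    show "size (filter_mset (\<lambda>J. i \<in> J \<and> j \<in> J) B) = size (filter_mset (\<lambda>J. i \<in> J \<and> j \<in> J) B')"
      if ij: "i \<le> j" "j \<le> m" for i j
    proof -
      have "card (carrier F) ^ size (filter_mset (\<lambda>J. i \<in> J \<and> j \<in> J) B) =
          card (carrier F) ^ size (filter_mset (\<lambda>J. i \<in> J \<and> j \<in> J) B')"
        using key[OF B] key[OF B'] ij by simp
      then show ?thesis
        by (simp only: power_inject_exp[OF F(2)])
    qed
    show "index_interval m J" if "J \<in># B" for J
      using key[OF B] that by blast
    show "index_interval m J" if "J \<in># B'" for J
      using key[OF B'] that by blast
  qed
qed

text \<open>Discharges the definite description in \<open>barcode\<close>. The bound on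
  \<open>card\<close> also encodes finiteness of the field, because \<open>card\<close> is 0 on
  infinite sets.\<close>

lemma barcode_eqI:
  fixes F :: "'k ring"
  assumes "\<zero>\<^bsub>F\<^esub> \<in> carrier F" "1 < card (carrier F)" "is_barcode F m M B"
  shows "barcode F m M = B"
  unfolding barcode_def using assms is_barcode_unique by blast

section \<open>Vector spaces of functions, quotients and sums\<close>

lemma vectorspaceI: "\<lbrakk>field K; module K V\<rbrakk> \<Longrightarrow> vectorspace K V"
  by (simp add: vectorspace_def)

text \<open>The axioms are inherited along a surjection compatible with the operations. Here
  \<open>q\<close> will be the projection onto a quotient.\<close>

lemma vectorspace_image:
  fixes K (structure)
  assumes V: "vectorspace K V" and W: "carrier W = q ` carrier V"
    and zero: "q \<zero>\<^bsub>V\<^esub> = \<zero>\<^bsub>W\<^esub>"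
    and add: "\<And>x y. \<lbrakk>x \<in> carrier V; y \<in> carrier V\<rbrakk> \<Longrightarrow> q x \<oplus>\<^bsub>W\<^esub> q y = q (x \<oplus>\<^bsub>V\<^esub> y)"
    and smult: "\<And>s x. \<lbrakk>s \<in> carrier K; x \<in> carrier V\<rbrakk> \<Longrightarrow> s \<odot>\<^bsub>W\<^esub> q x = q (s \<odot>\<^bsub>V\<^esub> x)"
  shows "vectorspace K W"
proof -
  interpret V: vectorspace K V by fact
  have "abelian_group W"
  proof (rule abelian_groupI)
    show "\<exists>y \<in> carrier W. y \<oplus>\<^bsub>W\<^esub> x = \<zero>\<^bsub>W\<^esub>" if x: "x \<in> carrier W" for x
    proof -
      obtain v where v: "v \<in> carrier V" "x = q v"
        using x W by auto
      then have "q (\<ominus>\<^bsub>V\<^esub> v) \<oplus>\<^bsub>W\<^esub> x = \<zero>\<^bsub>W\<^esub>"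
        using add zero by (simp add: V.M.l_neg)
      then show ?thesis
        using v W by blast
    qed
    show "\<zero>\<^bsub>W\<^esub> \<in> carrier W"
      using W zero by (metis V.M.zero_closed image_eqI)
    show "\<zero>\<^bsub>W\<^esub> \<oplus>\<^bsub>W\<^esub> x = x" if "x \<in> carrier W" for x
      using that W add[OF V.M.zero_closed] zero by auto
  qed (auto simp: W add V.M.a_ac)
  then have "module K W"
    by (intro moduleI V.R.is_cring)
      (auto simp: W add smult V.smult_l_distr V.smult_r_distr V.smult_assoc1)
  then show ?thesis
    by (rule vectorspaceI[OF V.field_axioms])
qed

context field
begin

text \<open>The parameters \<open>u\<close> and \<open>w\<close> stand for the unspecified ring
  fields of the module record, so that the result applies to \<open>chain_space\<close> as
  defined.\<close>

lemma vectorspace_functions: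
  assumes Z: "Z \<subseteq> fun_space R Y" "(\<lambda>x. \<zero>) \<in> Z"
    "\<And>c c'. \<lbrakk>c \<in> Z; c' \<in> Z\<rbrakk> \<Longrightarrow> (\<lambda>x. c x \<oplus> c' x) \<in> Z"
    "\<And>s c. \<lbrakk>s \<in> carrier R; c \<in> Z\<rbrakk> \<Longrightarrow> (\<lambda>x. s \<otimes> c x) \<in> Z"
  shows "vectorspace R \<lparr>carrier = Z, monoid.mult = u, one = w, zero = (\<lambda>x. \<zero>),
    add = (\<lambda>c c' x. c x \<oplus> c' x), smult = (\<lambda>s c x. s \<otimes> c x)\<rparr>" (is "vectorspace R ?V")
proof (rule vectorspaceI)
  have cl: "c x \<in> carrier R" if "c \<in> Z" for c x
    using that Z(1) fun_space_closed by fast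
  have "abelian_group ?V"
  proof (rule abelian_groupI)
    show "\<exists>y \<in> carrier ?V. y \<oplus>\<^bsub>?V\<^esub> c = \<zero>\<^bsub>?V\<^esub>" if "c \<in> carrier ?V" for c
      using that Z(4)[of "\<ominus> \<one>" c] cl
      by (intro bexI[of _ "\<lambda>x. \<ominus> \<one> \<otimes> c x"]) (auto simp: l_minus l_neg)
  qed (use Z cl in \<open>auto simp: a_assoc intro!: ext a_comm\<close>)
  then show "module R ?V"
    using cl Z(4) by (intro moduleI is_cring) (auto simp: l_distr r_distr m_assoc)
qed (rule field_axioms)

end

locale subspace_pair = vectorspace K V
  for K :: "('k, 'm) ring_scheme" (structure) and V :: "('k, 'a) module" +
  fixes U :: "'a set"
  assumes U_sub: "U \<subseteq> carrier V" and U_zero: "\<zero>\<^bsub>V\<^esub> \<in> U"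
    and U_add: "\<And>x y. \<lbrakk>x \<in> U; y \<in> U\<rbrakk> \<Longrightarrow> x \<oplus>\<^bsub>V\<^esub> y \<in> U"
    and U_smult: "\<And>s x. \<lbrakk>s \<in> carrier K; x \<in> U\<rbrakk> \<Longrightarrow> s \<odot>\<^bsub>V\<^esub> x \<in> U"
begin

lemma U_neg: "x \<in> U \<Longrightarrow> \<ominus>\<^bsub>V\<^esub> x \<in> U"
  using U_smult[of "\<ominus> \<one>" x] U_sub smult_l_minus[of \<one> x] by auto

lemma abelian_subgroup_U: "abelian_subgroup U V"
proof (rule abelian_subgroupI3)
  show "additive_subgroup U V"
    using U_sub U_zero U_add U_neg
    by (intro additive_subgroup.intro M.add.subgroupI) (auto simp: a_inv_def[symmetric])
qed (rule M.abelian_group_axioms)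

sublocale abelian_subgroup U V
  by (rule abelian_subgroup_U)

lemma mem_coset_iff:
  assumes "x \<in> carrier V"
  shows "y \<in> U +>\<^bsub>V\<^esub> x \<longleftrightarrow> y \<in> carrier V \<and> y \<ominus>\<^bsub>V\<^esub> x \<in> U"
proof
  assume "y \<in> U +>\<^bsub>V\<^esub> x"
  then obtain u where u: "u \<in> U" "y = u \<oplus>\<^bsub>V\<^esub> x"
    by (auto simp: a_r_coset_def')
  have u': "u \<in> carrier V"
    using u(1) U_sub by blast
  show "y \<in> carrier V \<and> y \<ominus>\<^bsub>V\<^esub> x \<in> U"
    using u u' assms by (simp add: M.minus_eq M.a_assoc M.r_neg)
next
  assume y: "y \<in> carrier V \<and> y \<ominus>\<^bsub>V\<^esub> x \<in> U"
  then have "y = (y \<ominus>\<^bsub>V\<^esub> x) \<oplus>\<^bsub>V\<^esub> x"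
    using assms by (simp add: M.minus_eq M.a_assoc M.l_neg)
  then show "y \<in> U +>\<^bsub>V\<^esub> x"
    using y by (auto simp: a_r_coset_def')
qed

lemma coset_eq_iff:
  assumes "x \<in> carrier V" "y \<in> carrier V"
  shows "U +>\<^bsub>V\<^esub> x = U +>\<^bsub>V\<^esub> y \<longleftrightarrow> x \<ominus>\<^bsub>V\<^esub> y \<in> U"
  using mem_coset_iff[of y x] assms a_rcos_self[OF assms(1)]
    a_repr_independence'[OF _ assms(2), of x] by auto

lemma coset_zero: "U +>\<^bsub>V\<^esub> \<zero>\<^bsub>V\<^esub> = U"
  using a_coset_add_zero[OF U_sub] .

text \<open>Scalar multiplication on the quotient is a union over all representatives. They all give
  the same coset, since \<open>U\<close> is closed under scalars, and the union is over a nonempty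
  set.\<close>

lemma smult_coset:
  assumes s: "s \<in> carrier K" and x: "x \<in> carrier V"
  shows "(\<Union>y \<in> U +>\<^bsub>V\<^esub> x. U +>\<^bsub>V\<^esub> (s \<odot>\<^bsub>V\<^esub> y)) = U +>\<^bsub>V\<^esub> (s \<odot>\<^bsub>V\<^esub> x)"
proof -
  have "U +>\<^bsub>V\<^esub> (s \<odot>\<^bsub>V\<^esub> y) = U +>\<^bsub>V\<^esub> (s \<odot>\<^bsub>V\<^esub> x)" if y: "y \<in> U +>\<^bsub>V\<^esub> x" for y
  proof -
    have y': "y \<in> carrier V" "y \<ominus>\<^bsub>V\<^esub> x \<in> U"
      using y mem_coset_iff[OF x] by auto
    have "s \<odot>\<^bsub>V\<^esub> y \<ominus>\<^bsub>V\<^esub> s \<odot>\<^bsub>V\<^esub> x = s \<odot>\<^bsub>V\<^esub> (y \<ominus>\<^bsub>V\<^esub> x)"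
      using s x y' by (simp add: M.minus_eq smult_r_distr smult_r_minus)
    then show ?thesis
      using U_smult[OF s y'(2)] s x y'(1) by (subst coset_eq_iff) auto
  qed
  moreover have "x \<in> U +>\<^bsub>V\<^esub> x"
    by (rule a_rcos_self[OF x])
  ultimately show ?thesis
    by blast
qed

lemma carrier_quotient: "carrier (quotient_space V U) = (\<lambda>x. U +>\<^bsub>V\<^esub> x) ` carrier V"
  by (auto simp: quotient_space_def A_RCOSETS_def')

lemma quotient_add:
  "\<lbrakk>x \<in> carrier V; y \<in> carrier V\<rbrakk> \<Longrightarrow>
    (U +>\<^bsub>V\<^esub> x) \<oplus>\<^bsub>quotient_space V U\<^esub> (U +>\<^bsub>V\<^esub> y) = U +>\<^bsub>V\<^esub> (x \<oplus>\<^bsub>V\<^esub> y)"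
  by (simp add: quotient_space_def a_rcos_sum)

lemma quotient_smult:
  "\<lbrakk>s \<in> carrier K; x \<in> carrier V\<rbrakk> \<Longrightarrow>
    s \<odot>\<^bsub>quotient_space V U\<^esub> (U +>\<^bsub>V\<^esub> x) = U +>\<^bsub>V\<^esub> (s \<odot>\<^bsub>V\<^esub> x)"
  by (simp add: quotient_space_def smult_coset)

lemma vectorspace_quotient: "vectorspace K (quotient_space V U)"
proof (rule vectorspace_image)
  show "vectorspace K V"
    by (rule vectorspace_axioms)
  show "U +>\<^bsub>V\<^esub> \<zero>\<^bsub>V\<^esub> = \<zero>\<^bsub>quotient_space V U\<^esub>"
    by (simp add: coset_zero) (simp add: quotient_space_def)
qed (simp_all add: carrier_quotient quotient_add quotient_smult)

end

lemma vectorspace_interval_sum: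
  fixes F :: "'k ring"
  assumes "field F"
  shows "vectorspace F (sp (interval_sum F Js) i)" (is "vectorspace F ?V")
proof (rule vectorspaceI)
  interpret field F by fact
  let ?I = "{..<length Js}"
  have mem: "x k \<in> carrier F" if "x \<in> carrier ?V" "k < length Js" for x k
    using PiE_mem[OF that(1)[unfolded carrier_interval_sum], of k] that(2)
    by (simp split: if_splits)
  have zero: "x k = \<zero>\<^bsub>F\<^esub>" if "x \<in> carrier ?V" "k < length Js" "i \<notin> Js ! k" for x k
    using PiE_mem[OF that(1)[unfolded carrier_interval_sum], of k] that(2,3) by simp
  have ext: "restrict x ?I = x" if "x \<in> carrier ?V" for x
    using that by (simp add: carrier_interval_sum PiE_restrict)
  have I: "restrict f ?I \<in> carrier ?V"
    if "\<And>k. k < length Js \<Longrightarrow> f k \<in> carrier F"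
      "\<And>k. \<lbrakk>k < length Js; i \<notin> Js ! k\<rbrakk> \<Longrightarrow> f k = \<zero>\<^bsub>F\<^esub>" for f
    using that unfolding carrier_interval_sum restrict_PiE_iff by simp
  have add: "x \<oplus>\<^bsub>?V\<^esub> y \<in> carrier ?V" if "x \<in> carrier ?V" "y \<in> carrier ?V" for x y
    unfolding add_interval_sum using that by (intro I) (simp_all add: mem zero)
  have smult: "s \<odot>\<^bsub>?V\<^esub> x \<in> carrier ?V" if "s \<in> carrier F" "x \<in> carrier ?V" for s x
    unfolding smult_interval_sum using that by (intro I) (simp_all add: mem zero)
  have "abelian_group ?V"
  proof (rule abelian_groupI)
    show "\<zero>\<^bsub>?V\<^esub> \<in> carrier ?V"
      unfolding zero_interval_sum by (intro I) simp_all
    show "\<zero>\<^bsub>?V\<^esub> \<oplus>\<^bsub>?V\<^esub> x = x" if "x \<in> carrier ?V" for x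
      using ext[OF that] mem[OF that]
      by (auto simp: add_interval_sum zero_interval_sum cong: restrict_cong)
    show "\<exists>y \<in> carrier ?V. y \<oplus>\<^bsub>?V\<^esub> x = \<zero>\<^bsub>?V\<^esub>" if "x \<in> carrier ?V" for x
    proof
      show "(\<lambda>k\<in>?I. \<ominus>\<^bsub>F\<^esub> x k) \<in> carrier ?V"
        using that by (intro I) (simp_all add: mem zero)
      show "(\<lambda>k\<in>?I. \<ominus>\<^bsub>F\<^esub> x k) \<oplus>\<^bsub>?V\<^esub> x = \<zero>\<^bsub>?V\<^esub>"
        using mem[OF that] by (auto simp: add_interval_sum zero_interval_sum l_neg cong: restrict_cong)
    qed
    show "x \<oplus>\<^bsub>?V\<^esub> y = y \<oplus>\<^bsub>?V\<^esub> x" if "x \<in> carrier ?V" "y \<in> carrier ?V" for x y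
      unfolding add_interval_sum using that by (intro restrict_ext a_comm) (simp_all add: mem)
    show "x \<oplus>\<^bsub>?V\<^esub> y \<oplus>\<^bsub>?V\<^esub> z = x \<oplus>\<^bsub>?V\<^esub> (y \<oplus>\<^bsub>?V\<^esub> z)"
      if "x \<in> carrier ?V" "y \<in> carrier ?V" "z \<in> carrier ?V" for x y z
      unfolding add_interval_sum using that by (intro restrict_ext) (simp add: mem a_assoc)
  qed (rule add)
  then show "module F ?V"
  proof (rule moduleI[OF is_cring])
    show "\<one>\<^bsub>F\<^esub> \<odot>\<^bsub>?V\<^esub> x = x" if "x \<in> carrier ?V" for x
      using ext[OF that] mem[OF that] by (auto simp: smult_interval_sum cong: restrict_cong)
    show "s \<odot>\<^bsub>?V\<^esub> x \<in> carrier ?V" if "s \<in> carrier F" "x \<in> carrier ?V" for s x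
      by (rule smult[OF that])
  qed (auto simp: smult_interval_sum add_interval_sum mem l_distr r_distr m_assoc
      intro!: restrict_ext)
qed fact

section \<open>The simplicial boundary operator\<close>

lemma (in abelian_monoid) finsum_swap:
  assumes "finite A" "finite B" "\<And>x y. \<lbrakk>x \<in> A; y \<in> B\<rbrakk> \<Longrightarrow> f x y \<in> carrier G"
  shows "(\<Oplus>x\<in>A. \<Oplus>y\<in>B. f x y) = (\<Oplus>y\<in>B. \<Oplus>x\<in>A. f x y)"
  using assms(1,3)
proof (induction A rule: finite_induct)
  case empty
  then show ?case
    by simp
next
  case (insert x A)
  have "(\<Oplus>x\<in>insert x A. \<Oplus>y\<in>B. f x y) = (\<Oplus>y\<in>B. f x y) \<oplus> (\<Oplus>y\<in>B. \<Oplus>x\<in>A. f x y)"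
    using insert by (simp add: Pi_def)
  also have "\<dots> = (\<Oplus>y\<in>B. f x y \<oplus> (\<Oplus>x\<in>A. f x y))"
    using insert by (simp add: finsum_addf Pi_def)
  also have "\<dots> = (\<Oplus>y\<in>B. \<Oplus>x\<in>insert x A. f x y)"
    using insert by (intro finsum_cong') (auto simp: Pi_def)
  finally show ?case .
qed

locale oriented_complex = field F for F :: "'k ring" (structure) +
  fixes K :: "'v set set" and \<nu> :: "'v \<Rightarrow> nat"
  assumes finite_K: "finite K" and cplx: "simplicial_cplx K" and inj: "inj_on \<nu> (\<Union>K)"
begin

lemma finite_simplex: "\<sigma> \<in> K \<Longrightarrow> finite \<sigma>"
  using cplx unfolding simplicial_cplx_def by blast

lemma simplex_nonempty: "\<sigma> \<in> K \<Longrightarrow> \<sigma> \<noteq> {}"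
  using cplx unfolding simplicial_cplx_def by blast

lemma simplex_face: "\<lbrakk>\<sigma> \<in> K; \<rho> \<noteq> {}; \<rho> \<subseteq> \<sigma>\<rbrakk> \<Longrightarrow> \<rho> \<in> K"
  using cplx unfolding simplicial_cplx_def by blast

lemma card_simplex: "\<sigma> \<in> K \<Longrightarrow> card \<sigma> = Suc (sdim \<sigma>)"
  using card_gt_0_iff[of \<sigma>] finite_simplex[of \<sigma>] simplex_nonempty[of \<sigma>] by (simp add: sdim_def)

lemma facet_iff:
  "facet K \<rho> \<tau> \<longleftrightarrow> \<rho> \<in> K \<and> \<tau> \<in> K \<and> (\<exists>v. v \<notin> \<rho> \<and> \<tau> = insert v \<rho>)"
proof
  assume f: "facet K \<rho> \<tau>"
  then have K: "\<rho> \<in> K" "\<tau> \<in> K" "\<rho> \<subseteq> \<tau>"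
    by (auto simp: facet_def)
  then have "card (\<tau> - \<rho>) = 1"
    using f finite_simplex card_simplex by (subst card_Diff_subset) (auto simp: facet_def)
  then obtain v where "\<tau> - \<rho> = {v}"
    using card_1_singletonE by blast
  then have "v \<notin> \<rho>" "\<tau> = insert v \<rho>"
    using K(3) by blast+
  then show "\<rho> \<in> K \<and> \<tau> \<in> K \<and> (\<exists>v. v \<notin> \<rho> \<and> \<tau> = insert v \<rho>)"
    using K by blast
next
  assume "\<rho> \<in> K \<and> \<tau> \<in> K \<and> (\<exists>v. v \<notin> \<rho> \<and> \<tau> = insert v \<rho>)"
  then obtain v where v: "\<rho> \<in> K" "\<tau> \<in> K" "v \<notin> \<rho>" "\<tau> = insert v \<rho>"
    by blast
  then have "sdim \<tau> = sdim \<rho> + 1"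
    using card_simplex[OF v(1)] finite_simplex[OF v(1)] by (simp add: sdim_def)
  then show "facet K \<rho> \<tau>"
    using v by (auto simp: facet_def)
qed

lemma finite_cofacets: "finite {\<tau>. facet K \<rho> \<tau>}"
  using finite_K by (rule finite_subset[rotated]) (auto simp: facet_def)

lemma incidence_closed [simp]: "incidence F \<nu> \<rho> \<tau> \<in> carrier F"
  by (simp add: incidence_def Let_def)

lemma incidence_nonzero: "incidence F \<nu> \<rho> \<tau> \<noteq> \<zero>"
  using minus_equality[of \<zero> \<one>] by (auto simp: incidence_def Let_def)

lemma incidence_insert:
  assumes "v \<notin> \<rho>"
  shows "incidence F \<nu> \<rho> (insert v \<rho>) =
    (if even (card {w \<in> \<rho>. \<nu> w < \<nu> v}) then \<one> else \<ominus> \<one>)"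
proof -
  have "insert v \<rho> - \<rho> = {v}" "{w \<in> insert v \<rho>. \<nu> w < \<nu> v} = {w \<in> \<rho>. \<nu> w < \<nu> v}"
    using assms by auto
  then show ?thesis
    by (simp add: incidence_def)
qed

text \<open>Say \<open>v\<close> precedes \<open>w\<close>. Inserting \<open>v\<close> raises the
  number of vertices below \<open>w\<close> by one and so flips the sign of \<open>w\<close>,
  whereas inserting \<open>w\<close> does not affect the sign of \<open>v\<close>. The two ways of
  adding both vertices thus get opposite signs.\<close>

lemma incidence_cancel:
  assumes K: "insert v (insert w \<rho>) \<in> K" and vw: "v \<notin> \<rho>" "w \<notin> \<rho>" "v \<noteq> w"
  shows "incidence F \<nu> \<rho> (insert v \<rho>) \<otimes> incidence F \<nu> (insert v \<rho>) (insert w (insert v \<rho>)) \<oplus>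
    incidence F \<nu> \<rho> (insert w \<rho>) \<otimes> incidence F \<nu> (insert w \<rho>) (insert v (insert w \<rho>)) = \<zero>"
proof -
  have *: "incidence F \<nu> \<rho> (insert v \<rho>) \<otimes> incidence F \<nu> (insert v \<rho>) (insert w (insert v \<rho>)) \<oplus>
    incidence F \<nu> \<rho> (insert w \<rho>) \<otimes> incidence F \<nu> (insert w \<rho>) (insert v (insert w \<rho>)) = \<zero>"
    if less: "\<nu> v < \<nu> w" and vw: "v \<notin> \<rho>" "w \<notin> \<rho>" "finite \<rho>" for v w
  proof -
    have "v \<noteq> w"
      using less by auto
    have "{x \<in> insert v \<rho>. \<nu> x < \<nu> w} = insert v {x \<in> \<rho>. \<nu> x < \<nu> w}"
      "{x \<in> insert w \<rho>. \<nu> x < \<nu> v} = {x \<in> \<rho>. \<nu> x < \<nu> v}"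
      using less by auto
    then show ?thesis
      using vw \<open>v \<noteq> w\<close> by (simp add: incidence_insert l_neg r_neg l_minus r_minus)
  qed
  have fin: "finite \<rho>"
    using finite_simplex[OF K] by simp
  have "\<nu> v \<noteq> \<nu> w"
    using inj K vw(3) by (auto dest: inj_onD)
  then consider "\<nu> v < \<nu> w" | "\<nu> w < \<nu> v"
    by linarith
  then show ?thesis
  proof cases
    case 1
    then show ?thesis
      using *[of v w] vw fin by simp
  next
    case 2
    then show ?thesis
      using *[of w v] vw fin by (simp add: a_comm)
  qed
qed

lemma boundary_closed: "(\<And>\<tau>. c \<tau> \<in> carrier F) \<Longrightarrow> boundary F \<nu> K c \<rho> \<in> carrier F"
  by (auto simp: boundary_def intro!: finsum_closed)

lemma boundary_add:
  assumes "\<And>\<tau>. c \<tau> \<in> carrier F" "\<And>\<tau>. c' \<tau> \<in> carrier F"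
  shows "boundary F \<nu> K (\<lambda>\<tau>. c \<tau> \<oplus> c' \<tau>) = (\<lambda>\<rho>. boundary F \<nu> K c \<rho> \<oplus> boundary F \<nu> K c' \<rho>)"
  using assms by (auto simp: boundary_def r_distr Pi_def finsum_addf)

lemma boundary_smult:
  assumes "s \<in> carrier F" "\<And>\<tau>. c \<tau> \<in> carrier F"
  shows "boundary F \<nu> K (\<lambda>\<tau>. s \<otimes> c \<tau>) = (\<lambda>\<rho>. s \<otimes> boundary F \<nu> K c \<rho>)"
  using assms by (auto simp: boundary_def m_lcomm Pi_def finite_cofacets finsum_rdistr)

lemma boundary_zero:
  assumes "\<And>\<tau>. facet K \<rho> \<tau> \<Longrightarrow> c \<tau> = \<zero>"
  shows "boundary F \<nu> K c \<rho> = \<zero>"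
  using assms by (auto simp: boundary_def intro!: add.finprod_one_eqI)

lemma boundary_single:
  assumes "c = (\<lambda>x. if x = \<tau> then \<one> else \<zero>)"
  shows "boundary F \<nu> K c \<rho> = (if facet K \<rho> \<tau> then incidence F \<nu> \<rho> \<tau> else \<zero>)"
proof (cases "facet K \<rho> \<tau>")
  case True
  then have "\<rho> \<in> K"
    by (simp add: facet_def)
  then have "boundary F \<nu> K c \<rho> = (\<Oplus>\<tau>'\<in>{\<tau>'. facet K \<rho> \<tau>'}. incidence F \<nu> \<rho> \<tau>' \<otimes> c \<tau>')"
    by (simp add: boundary_def)
  also have "\<dots> = (\<Oplus>\<tau>'\<in>{\<tau>'. facet K \<rho> \<tau>'}. if \<tau> = \<tau>' then incidence F \<nu> \<rho> \<tau>' else \<zero>)"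
    by (rule finsum_cong') (simp_all add: assms)
  also have "\<dots> = incidence F \<nu> \<rho> \<tau>"
    using True finite_cofacets by (intro finsum_singleton) auto
  finally show ?thesis
    using True by simp
next
  case False
  then have "boundary F \<nu> K c \<rho> = \<zero>"
    unfolding assms by (intro boundary_zero) auto
  then show ?thesis
    using False by simp
qed

lemma boundary_boundary:
  assumes c: "\<And>\<tau>. c \<tau> \<in> carrier F"
  shows "boundary F \<nu> K (boundary F \<nu> K c) = (\<lambda>\<rho>. \<zero>)"
proof
  fix \<rho>
  show "boundary F \<nu> K (boundary F \<nu> K c) \<rho> = \<zero>"
  proof (cases "\<rho> \<in> K")
    case False
    then show ?thesis
      by (simp add: boundary_def)
  next
    case True
    let ?i = "incidence F \<nu>" and ?A = "{\<sigma>. facet K \<rho> \<sigma>}"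
    \<comment> \<open>Extension by zero lets the inner sum run over all of \<open>K\<close>,
      independently of \<open>\<sigma>\<close>, so that the two sums can be exchanged.\<close>
    define g where "g \<sigma> \<tau> = (if facet K \<sigma> \<tau> then ?i \<rho> \<sigma> \<otimes> (?i \<sigma> \<tau> \<otimes> c \<tau>) else \<zero>)" for \<sigma> \<tau>
    have g: "g \<sigma> \<tau> \<in> carrier F" for \<sigma> \<tau>
      using c by (simp add: g_def)
    have inner: "?i \<rho> \<sigma> \<otimes> boundary F \<nu> K c \<sigma> = (\<Oplus>\<tau>\<in>K. g \<sigma> \<tau>)" if "facet K \<rho> \<sigma>" for \<sigma>
    proof -
      have "?i \<rho> \<sigma> \<otimes> boundary F \<nu> K c \<sigma> = (\<Oplus>\<tau>\<in>{\<tau>. facet K \<sigma> \<tau>}. ?i \<rho> \<sigma> \<otimes> (?i \<sigma> \<tau> \<otimes> c \<tau>))"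
        using that c finite_cofacets by (auto simp: boundary_def facet_def[of K \<rho>] finsum_rdistr)
      also have "\<dots> = (\<Oplus>\<tau>\<in>K. g \<sigma> \<tau>)"
        using finite_K c by (intro add.finprod_mono_neutral_cong_left)
          (auto simp: g_def facet_def)
      finally show ?thesis .
    qed
    \<comment> \<open>For a fixed \<open>\<tau>\<close> two dimensions above \<open>\<rho>\<close>
      exactly two simplices lie in between, one for each missing vertex, and their contributions
      cancel.\<close>
    have zero: "(\<Oplus>\<sigma>\<in>?A. g \<sigma> \<tau>) = \<zero>" for \<tau>
    proof (cases "\<exists>\<sigma>. facet K \<rho> \<sigma> \<and> facet K \<sigma> \<tau>")
      case False
      then show ?thesis
        by (intro add.finprod_one_eqI) (auto simp: g_def)
    next
      case True
      then obtain \<sigma> v w where v: "v \<notin> \<rho>" "\<sigma> = insert v \<rho>" and w: "w \<notin> \<sigma>" "\<tau> = insert w \<sigma>"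
        and K: "\<sigma> \<in> K" "\<tau> \<in> K"
        by (auto simp: facet_iff)
      have wK: "insert w \<rho> \<in> K"
        using simplex_face[OF K(2), of "insert w \<rho>"] v w by auto
      have f: "facet K \<rho> (insert v \<rho>)" "facet K (insert v \<rho>) \<tau>"
        "facet K \<rho> (insert w \<rho>)" "facet K (insert w \<rho>) \<tau>"
        using v w K wK \<open>\<rho> \<in> K\<close> unfolding facet_iff by auto
      have between: "\<sigma>' = insert v \<rho> \<or> \<sigma>' = insert w \<rho>" if "facet K \<rho> \<sigma>'" "facet K \<sigma>' \<tau>" for \<sigma>'
      proof -
        obtain u where u: "u \<notin> \<rho>" "\<sigma>' = insert u \<rho>"
          using \<open>facet K \<rho> \<sigma>'\<close> by (auto simp: facet_iff)
        moreover have "u \<in> \<tau>"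
          using \<open>facet K \<sigma>' \<tau>\<close> u by (auto simp: facet_def)
        ultimately show ?thesis
          using v w by auto
      qed
      have "(\<Oplus>\<sigma>\<in>?A. g \<sigma> \<tau>) = (\<Oplus>\<sigma>\<in>{insert v \<rho>, insert w \<rho>}. g \<sigma> \<tau>)"
        using f g finite_cofacets between
        by (intro add.finprod_mono_neutral_cong_right) (auto simp: g_def)
      also have "\<dots> = g (insert v \<rho>) \<tau> \<oplus> g (insert w \<rho>) \<tau>"
        using g v w by (subst finsum_insert) auto
      also have "\<dots> = (?i \<rho> (insert v \<rho>) \<otimes> ?i (insert v \<rho>) \<tau> \<oplus> ?i \<rho> (insert w \<rho>) \<otimes> ?i (insert w \<rho>) \<tau>) \<otimes> c \<tau>"
        using f c by (simp add: g_def l_distr m_assoc)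
      also have "?i \<rho> (insert v \<rho>) \<otimes> ?i (insert v \<rho>) \<tau> \<oplus> ?i \<rho> (insert w \<rho>) \<otimes> ?i (insert w \<rho>) \<tau> = \<zero>"
        using incidence_cancel[of v w \<rho>] v w K by (auto simp: insert_commute)
      finally show ?thesis
        using c by simp
    qed
    have "boundary F \<nu> K (boundary F \<nu> K c) \<rho> = (\<Oplus>\<sigma>\<in>?A. ?i \<rho> \<sigma> \<otimes> boundary F \<nu> K c \<sigma>)"
      using True by (simp add: boundary_def[of F \<nu> K "boundary F \<nu> K c"])
    also have "\<dots> = (\<Oplus>\<sigma>\<in>?A. \<Oplus>\<tau>\<in>K. g \<sigma> \<tau>)"
      using inner g by (intro finsum_cong') auto
    also have "\<dots> = (\<Oplus>\<tau>\<in>K. \<Oplus>\<sigma>\<in>?A. g \<sigma> \<tau>)"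
      using finite_cofacets finite_K g by (intro finsum_swap) auto
    also have "\<dots> = \<zero>"
      by (rule add.finprod_one_eqI) (rule zero)
    finally show ?thesis .
  qed
qed

text \<open>Homology of a stage is defined with the boundary operator of that stage, while the
  reduction works with the single operator of \<open>K\<close>. On chains of a face-closed part they
  agree: cofacets outside it have coefficient zero, and no facet leaves it.\<close>

lemma boundary_subcomplex:
  assumes X: "X \<subseteq> K" "\<And>\<rho> \<tau>. \<lbrakk>facet K \<rho> \<tau>; \<tau> \<in> X\<rbrakk> \<Longrightarrow> \<rho> \<in> X" and c: "c \<in> fun_space F X"
  shows "boundary F \<nu> X c = boundary F \<nu> K c"
proof
  fix \<rho>
  show "boundary F \<nu> X c \<rho> = boundary F \<nu> K c \<rho>"
  proof (cases "\<rho> \<in> X")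
    case True
    have "(\<Oplus>\<tau>\<in>{\<tau>. facet X \<rho> \<tau>}. incidence F \<nu> \<rho> \<tau> \<otimes> c \<tau>) =
        (\<Oplus>\<tau>\<in>{\<tau>. facet K \<rho> \<tau>}. incidence F \<nu> \<rho> \<tau> \<otimes> c \<tau>)"
    proof (rule add.finprod_mono_neutral_cong_left)
      show "incidence F \<nu> \<rho> \<tau> \<otimes> c \<tau> = \<zero>" if "\<tau> \<in> {\<tau>. facet K \<rho> \<tau>} - {\<tau>. facet X \<rho> \<tau>}" for \<tau>
        using that fun_space_outside[OF c, of \<tau>] True by (auto simp: facet_def)
    qed (use X(1) finite_cofacets fun_space_closed[OF c] in \<open>auto simp: facet_def\<close>)
    then show ?thesis
      using True X(1) by (auto simp: boundary_def)
  next
    case False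
    have "boundary F \<nu> K c \<rho> = \<zero>"
      using X(2) fun_space_outside[OF c] False by (intro boundary_zero) blast
    then show ?thesis
      using False by (simp add: boundary_def)
  qed
qed

end

section \<open>Simplexwise filtrations as filtered complexes\<close>

locale filtered_oriented_complex = oriented_complex F K \<nu>
  for F :: "'k ring" (structure) and K :: "'v set set" and \<nu> +
  fixes \<sigma>s :: "'v set list"
  assumes filtration: "simplexwise_filtration K \<sigma>s"
begin

lemma set_order: "set \<sigma>s = K"
  using filtration by (simp add: simplexwise_filtration_def)

lemma filt_sub: "filt \<sigma>s n \<subseteq> K"
  unfolding filt_def using set_take_subset set_order by metis

lemma facet_obtain_index:
  assumes "facet K \<rho> \<tau>"
  obtains k l where "k < l" "l < length \<sigma>s" "\<rho> = \<sigma>s ! k" "\<tau> = \<sigma>s ! l"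
proof -
  obtain k l where "k < length \<sigma>s" "l < length \<sigma>s" "\<rho> = \<sigma>s ! k" "\<tau> = \<sigma>s ! l"
    using assms set_order unfolding facet_def by (metis in_set_conv_nth)
  moreover from this have "k < l"
    using assms filtration by (simp add: facet_def simplexwise_filtration_def)
  ultimately show ?thesis
    using that by blast
qed

lemma nth_in_take_iff: "k < length \<sigma>s \<Longrightarrow> \<sigma>s ! k \<in> set (take n \<sigma>s) \<longleftrightarrow> k < n"
  using filtration
  by (auto simp: simplexwise_filtration_def in_set_conv_nth nth_eq_iff_index_eq)

sublocale filtered_complex F \<sigma>s sdim "boundary F \<nu> K"
proof
  show "distinct \<sigma>s"
    using filtration by (simp add: simplexwise_filtration_def)
  show "boundary F \<nu> K (\<lambda>x. c x \<oplus> c' x) = (\<lambda>x. boundary F \<nu> K c x \<oplus> boundary F \<nu> K c' x)"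
    if "c \<in> fun_space F (set \<sigma>s)" "c' \<in> fun_space F (set \<sigma>s)" for c c'
    using that by (intro boundary_add) (rule fun_space_closed, assumption)+
  show "boundary F \<nu> K (\<lambda>x. s \<otimes> c x) = (\<lambda>x. s \<otimes> boundary F \<nu> K c x)"
    if "s \<in> carrier F" "c \<in> fun_space F (set \<sigma>s)" for s c
    using that(1) fun_space_closed[OF that(2)] by (rule boundary_smult)
  show "boundary F \<nu> K (boundary F \<nu> K c) = (\<lambda>x. \<zero>)" if "c \<in> fun_space F (set \<sigma>s)" for c
    using fun_space_closed[OF that] by (rule boundary_boundary)
  show "boundary F \<nu> K c \<in> fun_space F (set (take n \<sigma>s))"
    if n: "n < length \<sigma>s" and c: "c \<in> fun_space F (set (take (Suc n) \<sigma>s))" for n c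
  proof (rule fun_spaceI)
    show "boundary F \<nu> K c \<rho> \<in> carrier F" for \<rho>
      using fun_space_closed[OF c] by (rule boundary_closed)
    fix \<rho>
    assume \<rho>: "\<rho> \<notin> set (take n \<sigma>s)"
    show "boundary F \<nu> K c \<rho> = \<zero>"
    proof (rule boundary_zero)
      fix \<tau>
      assume "facet K \<rho> \<tau>"
      then obtain k l where kl: "k < l" "l < length \<sigma>s" "\<rho> = \<sigma>s ! k" "\<tau> = \<sigma>s ! l"
        by (rule facet_obtain_index)
      \<comment> \<open>A cofacet stands strictly after its facet: from \<open>k \<ge> n\<close>
        follows \<open>l \<ge> n + 1\<close>.\<close>
      then have "\<tau> \<notin> set (take (Suc n) \<sigma>s)"
        using \<rho> nth_in_take_iff by auto
      then show "c \<tau> = \<zero>"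
        using c by (rule fun_space_outside[rotated])
    qed
  qed
  show "boundary F \<nu> K c \<rho> = \<zero>"
    if "c \<in> fun_space F (set \<sigma>s)" "\<And>\<tau>. sdim \<tau> = Suc (sdim \<rho>) \<Longrightarrow> c \<tau> = \<zero>" for c \<rho>
    using that(2) by (intro boundary_zero) (simp add: facet_def)
qed

lemma boundary_filt: "c \<in> V_upto n \<Longrightarrow> boundary F \<nu> (filt \<sigma>s n) c = boundary F \<nu> K c"
proof (rule boundary_subcomplex[OF filt_sub])
  fix \<rho> \<tau>
  assume "facet K \<rho> \<tau>" and \<tau>: "\<tau> \<in> filt \<sigma>s n"
  then obtain k l where "k < l" "l < length \<sigma>s" "\<rho> = \<sigma>s ! k" "\<tau> = \<sigma>s ! l"
    by (blast elim: facet_obtain_index)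
  then show "\<rho> \<in> filt \<sigma>s n"
    using \<tau> nth_in_take_iff by (simp add: filt_def)
qed (simp add: filt_def)

lemma boundary_unit_chain: "boundary F \<nu> K (unit_chain j) \<rho> =
    (if facet K \<rho> (\<sigma>s ! j) then incidence F \<nu> \<rho> (\<sigma>s ! j) else \<zero>)"
  by (rule boundary_single) (simp add: unit_chain_def)

end

section \<open>The barcode of a filtered complex\<close>

lemma linear_mapI:
  assumes "vectorspace K V" "vectorspace K W"
    and "\<And>x. x \<in> carrier V \<Longrightarrow> T x \<in> carrier W"
    and "\<And>x y. \<lbrakk>x \<in> carrier V; y \<in> carrier V\<rbrakk> \<Longrightarrow> T (x \<oplus>\<^bsub>V\<^esub> y) = T x \<oplus>\<^bsub>W\<^esub> T y"
    and "\<And>s x. \<lbrakk>s \<in> carrier K; x \<in> carrier V\<rbrakk> \<Longrightarrow> T (s \<odot>\<^bsub>V\<^esub> x) = s \<odot>\<^bsub>W\<^esub> T x"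
  shows "linear_map K V W T"
  using assms
  by (auto simp: linear_map_def mod_hom_def mod_hom_axioms_def module_hom_def vectorspace_def)

locale homology_reduction =
  filtered_oriented_complex F K \<nu> \<sigma>s + full_reduction F \<sigma>s sdim "boundary F \<nu> K" a br
  for F :: "'k ring" (structure) and K :: "'v set set" and \<nu> \<sigma>s a br
begin

abbreviation "bd \<equiv> boundary F \<nu> K"

text \<open>If the partner of \<open>j\<close> were itself a death index, two applications of the
  boundary to the basis vector \<open>j\<close> would give a nonzero chain.\<close>

lemma birth_unpaired:
  assumes "br j = Some i"
  shows "br i = None"
proof (rule ccontr)
  assume "br i \<noteq> None"
  then obtain q where q: "br i = Some q"
    by blast
  have less: "j < length \<sigma>s" "q < length \<sigma>s"
    using br_less[OF assms] br_less[OF q] by auto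
  obtain z where z: "z \<in> C (length \<sigma>s) (sdim (\<sigma>s ! j))"
    "\<forall>k < length \<sigma>s. a k z = (if k = j then \<one> else \<zero>)"
    using a_surj[of "length \<sigma>s" "\<lambda>k. if k = j then \<one> else \<zero>" "sdim (\<sigma>s ! j)"] by fastforce
  have zV: "z \<in> V" "z \<in> V_upto (length \<sigma>s)"
    using C_V[OF z(1)] by simp_all
  have "\<one> = a i (bd z)"
    using a_D_paired[OF assms zV(2)] z(2) less by simp
  also have "\<dots> = a q (bd (bd z))"
    using a_D_paired[OF q] D_V[OF zV(1)] by simp
  also have "\<dots> = \<zero>"
    using D_D[OF zV(1)] a_zero less by simp
  finally show False
    by simp
qed

section \<open>Homology of the stages as cosets of cycles\<close>

lemma carrier_chain_space: "carrier (chain_space F (filt \<sigma>s n) d) = C n d"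
  by (simp add: chain_space_def C_def fun_space_def filt_def)

lemma cycles_eq: "cycles F \<nu> (filt \<sigma>s n) d = {z \<in> C n d. bd z = (\<lambda>x. \<zero>)}"
  using boundary_filt[OF C_V_upto] by (auto simp: cycles_def carrier_chain_space)

lemma boundaries_eq: "boundaries F \<nu> (filt \<sigma>s n) d = bd ` C n (Suc d)"
  using boundary_filt[OF C_V_upto] by (auto simp: boundaries_def carrier_chain_space intro!: image_cong)

abbreviation "Z n d \<equiv> cycles F \<nu> (filt \<sigma>s n) d"
abbreviation "B n d \<equiv> boundaries F \<nu> (filt \<sigma>s n) d"
abbreviation "ZS n d \<equiv> (chain_space F (filt \<sigma>s n) d)\<lparr>carrier := Z n d\<rparr>"
abbreviation "cls n d z \<equiv> B n d +>\<^bsub>ZS n d\<^esub> z"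

lemma Z_V: "z \<in> Z n d \<Longrightarrow> z \<in> V"
  using C_V by (auto simp: cycles_eq)

lemma Z_add: "\<lbrakk>z \<in> Z n d; z' \<in> Z n d\<rbrakk> \<Longrightarrow> (\<lambda>x. z x \<oplus> z' x) \<in> Z n d"
  using D_add[OF C_V C_V] by (auto simp: cycles_eq C_def fun_space_add)

lemma Z_smult: "\<lbrakk>s \<in> carrier F; z \<in> Z n d\<rbrakk> \<Longrightarrow> (\<lambda>x. s \<otimes> z x) \<in> Z n d"
  using D_smult[OF _ C_V] by (auto simp: cycles_eq C_def fun_space_smult)

lemma Z_zero: "(\<lambda>x. \<zero>) \<in> Z n d"
  using boundary_zero[of _ "\<lambda>x. \<zero>"] by (auto simp: cycles_eq C_def fun_space_zero)

lemma B_sub_Z: "B n d \<subseteq> Z n d"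
  using D_C D_D C_V by (auto simp: cycles_eq boundaries_eq)

lemma B_add:
  assumes "b \<in> B n d" "b' \<in> B n d"
  shows "(\<lambda>x. b x \<oplus> b' x) \<in> B n d"
proof -
  obtain w w' where w: "w \<in> C n (Suc d)" "b = bd w" and w': "w' \<in> C n (Suc d)" "b' = bd w'"
    using assms unfolding boundaries_eq by blast
  have "(\<lambda>x. w x \<oplus> w' x) \<in> C n (Suc d)"
    using w(1) w'(1) unfolding C_def by (rule fun_space_add)
  then show ?thesis
    unfolding boundaries_eq w(2) w'(2) D_add[OF C_V[OF w(1)] C_V[OF w'(1)], symmetric]
    by (rule imageI)
qed

lemma B_smult:
  assumes "s \<in> carrier F" "b \<in> B n d"
  shows "(\<lambda>x. s \<otimes> b x) \<in> B n d"
proof -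
  obtain w where w: "w \<in> C n (Suc d)" "b = bd w"
    using assms unfolding boundaries_eq by blast
  have "(\<lambda>x. s \<otimes> w x) \<in> C n (Suc d)"
    using assms(1) w(1) unfolding C_def by (rule fun_space_smult)
  then show ?thesis
    unfolding boundaries_eq w(2) D_smult[OF assms(1) C_V[OF w(1)], symmetric] by (rule imageI)
qed

lemma B_zero: "(\<lambda>x. \<zero>) \<in> B n d"
proof -
  have "bd (\<lambda>x. \<zero>) = (\<lambda>x. \<zero>)"
    using boundary_zero[of _ "\<lambda>x. \<zero>"] by auto
  moreover have "(\<lambda>x. \<zero>) \<in> C n (Suc d)"
    by (simp add: C_def fun_space_zero)
  ultimately show ?thesis
    unfolding boundaries_eq by (metis imageI)
qed

lemma vectorspace_ZS: "vectorspace F (ZS n d)"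
proof -
  have "Z n d \<subseteq> fun_space F (set \<sigma>s)"
    using Z_V by blast
  then have "vectorspace F \<lparr>carrier = Z n d, monoid.mult = undefined, one = undefined,
      zero = (\<lambda>x. \<zero>), add = (\<lambda>c c' x. c x \<oplus> c' x), smult = (\<lambda>s c x. s \<otimes> c x)\<rparr>"
    by (rule vectorspace_functions[OF _ Z_zero Z_add Z_smult])
  moreover have "ZS n d = \<lparr>carrier = Z n d, monoid.mult = undefined, one = undefined,
      zero = (\<lambda>x. \<zero>), add = (\<lambda>c c' x. c x \<oplus> c' x), smult = (\<lambda>s c x. s \<otimes> c x)\<rparr>"
    unfolding chain_space_def by simp
  ultimately show ?thesis
    by (simp only:)
qed

lemma chain_space_ops:
  "z \<oplus>\<^bsub>chain_space F X d\<^esub> z' = (\<lambda>x. z x \<oplus> z' x)"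
  "s \<odot>\<^bsub>chain_space F X d\<^esub> z = (\<lambda>x. s \<otimes> z x)"
  by (simp_all add: chain_space_def)

lemma ZS_simps:
  "carrier (ZS n d) = Z n d" "z \<oplus>\<^bsub>ZS n d\<^esub> z' = (\<lambda>x. z x \<oplus> z' x)"
  "s \<odot>\<^bsub>ZS n d\<^esub> z = (\<lambda>x. s \<otimes> z x)" "\<zero>\<^bsub>ZS n d\<^esub> = (\<lambda>x. \<zero>)"
  by (simp_all add: chain_space_def)

lemma subspace_pair: "subspace_pair F (ZS n d) (B n d)"
proof -
  interpret vectorspace F "ZS n d"
    by (rule vectorspace_ZS)
  show ?thesis
  proof unfold_locales
    show "B n d \<subseteq> carrier (ZS n d)"
      unfolding ZS_simps by (rule B_sub_Z)
    show "\<zero>\<^bsub>ZS n d\<^esub> \<in> B n d"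
      unfolding ZS_simps by (rule B_zero)
    show "b \<oplus>\<^bsub>ZS n d\<^esub> b' \<in> B n d" if "b \<in> B n d" "b' \<in> B n d" for b b'
      unfolding ZS_simps using that by (rule B_add)
    show "s \<odot>\<^bsub>ZS n d\<^esub> b \<in> B n d" if "s \<in> carrier F" "b \<in> B n d" for s b
      unfolding ZS_simps using that by (rule B_smult)
  qed
qed

lemma cls_eq: "cls n d z = {y. \<exists>b \<in> B n d. y = (\<lambda>x. b x \<oplus> z x)}"
  by (auto simp: a_r_coset_def' chain_space_def)

lemma self_in_cls: "z \<in> Z n d \<Longrightarrow> z \<in> cls n d z"
  unfolding cls_eq using B_zero fun_space_closed[OF Z_V] by (intro CollectI bexI[of _ "\<lambda>x. \<zero>"]) auto

lemma vectorspace_homology: "vectorspace F (homology F \<nu> (filt \<sigma>s n) d)"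
  unfolding homology_def by (rule subspace_pair.vectorspace_quotient[OF subspace_pair])

lemma carrier_homology: "carrier (homology F \<nu> (filt \<sigma>s n) d) = cls n d ` Z n d"
  unfolding homology_def subspace_pair.carrier_quotient[OF subspace_pair] by (simp add: ZS_simps)

lemma homology_add: "\<lbrakk>z \<in> Z n d; z' \<in> Z n d\<rbrakk> \<Longrightarrow>
    cls n d z \<oplus>\<^bsub>homology F \<nu> (filt \<sigma>s n) d\<^esub> cls n d z' = cls n d (\<lambda>x. z x \<oplus> z' x)"
  using subspace_pair.quotient_add[OF subspace_pair, of z n d z']
  by (simp add: homology_def chain_space_ops ZS_simps(1))

lemma homology_smult: "\<lbrakk>s \<in> carrier F; z \<in> Z n d\<rbrakk> \<Longrightarrow>
    s \<odot>\<^bsub>homology F \<nu> (filt \<sigma>s n) d\<^esub> cls n d z = cls n d (\<lambda>x. s \<otimes> z x)"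
  using subspace_pair.quotient_smult[OF subspace_pair, of s z n d]
  by (simp add: homology_def chain_space_ops ZS_simps(1))

lemma Z_mono: "n \<le> n' \<Longrightarrow> Z n d \<subseteq> Z n' d"
  using C_mono by (auto simp: cycles_eq)

lemma B_mono: "n \<le> n' \<Longrightarrow> B n d \<subseteq> B n' d"
  unfolding boundaries_eq by (intro image_mono C_mono)

text \<open>The structure map adds all boundaries of the later stage to a coset; those of the
  earlier stage are among them and get absorbed.\<close>

lemma tr_cls:
  assumes "n \<le> n'" "z \<in> Z n d"
  shows "tr (homology_pmod F \<nu> \<sigma>s d) n n' (cls n d z) = cls n' d z"
proof -
  have closed: "z x \<in> carrier F" "b \<in> B n' d \<Longrightarrow> b x \<in> carrier F" for b x
    using fun_space_closed[OF Z_V] assms(2) B_sub_Z by blast+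
  have "tr (homology_pmod F \<nu> \<sigma>s d) n n' (cls n d z) =
      {y. \<exists>b' \<in> B n' d. \<exists>b \<in> B n d. y = (\<lambda>x. b' x \<oplus> (b x \<oplus> z x))}"
    by (auto simp: homology_pmod_def set_add_def' cls_eq chain_space_ops)
  also have "\<dots> = cls n' d z"
  proof
    show "{y. \<exists>b' \<in> B n' d. \<exists>b \<in> B n d. y = (\<lambda>x. b' x \<oplus> (b x \<oplus> z x))} \<subseteq> cls n' d z"
    proof
      fix y
      assume "y \<in> {y. \<exists>b' \<in> B n' d. \<exists>b \<in> B n d. y = (\<lambda>x. b' x \<oplus> (b x \<oplus> z x))}"
      then obtain b' b where b: "b' \<in> B n' d" "b \<in> B n' d" "y = (\<lambda>x. b' x \<oplus> (b x \<oplus> z x))"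
        using B_mono[OF assms(1)] by blast
      then have "y = (\<lambda>x. (b' x \<oplus> b x) \<oplus> z x)"
        using closed by (simp add: a_assoc)
      then show "y \<in> cls n' d z"
        unfolding cls_eq
        by (intro CollectI bexI[of _ "\<lambda>x. b' x \<oplus> b x"] B_add[OF b(1,2)])
    qed
    show "cls n' d z \<subseteq> {y. \<exists>b' \<in> B n' d. \<exists>b \<in> B n d. y = (\<lambda>x. b' x \<oplus> (b x \<oplus> z x))}"
    proof
      fix y
      assume "y \<in> cls n' d z"
      then obtain b' where b': "b' \<in> B n' d" "y = (\<lambda>x. b' x \<oplus> z x)"
        unfolding cls_eq by blast
      then have "y = (\<lambda>x. b' x \<oplus> (\<zero> \<oplus> z x))"
        using closed by simp
      then show "y \<in> {y. \<exists>b' \<in> B n' d. \<exists>b \<in> B n d. y = (\<lambda>x. b' x \<oplus> (b x \<oplus> z x))}"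
        by (intro CollectI bexI[OF _ b'(1)] bexI[OF _ B_zero])
    qed
  qed
  finally show ?thesis .
qed

lemma persistence_module_homology: "persistence_module F (length \<sigma>s) (homology_pmod F \<nu> \<sigma>s d)"
proof -
  have sp: "sp (homology_pmod F \<nu> \<sigma>s d) n = homology F \<nu> (filt \<sigma>s n) d" for n
    by (simp add: homology_pmod_def)
  have "linear_map F (sp (homology_pmod F \<nu> \<sigma>s d) n) (sp (homology_pmod F \<nu> \<sigma>s d) n')
      (tr (homology_pmod F \<nu> \<sigma>s d) n n')" if le: "n \<le> n'" for n n'
    unfolding sp
  proof (rule linear_mapI[OF vectorspace_homology vectorspace_homology])
    have Z': "z \<in> Z n' d" if "z \<in> Z n d" for z
      using Z_mono[OF le] that by blast
    show "tr (homology_pmod F \<nu> \<sigma>s d) n n' S \<in> carrier (homology F \<nu> (filt \<sigma>s n') d)"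
      if "S \<in> carrier (homology F \<nu> (filt \<sigma>s n) d)" for S
      using that Z' by (auto simp: carrier_homology tr_cls[OF le])
    show "tr (homology_pmod F \<nu> \<sigma>s d) n n' (S \<oplus>\<^bsub>homology F \<nu> (filt \<sigma>s n) d\<^esub> T) =
        tr (homology_pmod F \<nu> \<sigma>s d) n n' S \<oplus>\<^bsub>homology F \<nu> (filt \<sigma>s n') d\<^esub>
        tr (homology_pmod F \<nu> \<sigma>s d) n n' T"
      if "S \<in> carrier (homology F \<nu> (filt \<sigma>s n) d)" "T \<in> carrier (homology F \<nu> (filt \<sigma>s n) d)" for S T
      using that Z' by (auto simp: carrier_homology homology_add tr_cls[OF le] Z_add)
    show "tr (homology_pmod F \<nu> \<sigma>s d) n n' (s \<odot>\<^bsub>homology F \<nu> (filt \<sigma>s n) d\<^esub> S) =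
        s \<odot>\<^bsub>homology F \<nu> (filt \<sigma>s n') d\<^esub> tr (homology_pmod F \<nu> \<sigma>s d) n n' S"
      if "s \<in> carrier F" "S \<in> carrier (homology F \<nu> (filt \<sigma>s n) d)" for s S
      using that Z' by (auto simp: carrier_homology homology_smult tr_cls[OF le] Z_smult)
  qed
  moreover have "tr (homology_pmod F \<nu> \<sigma>s d) n n S = S" if "S \<in> carrier (sp (homology_pmod F \<nu> \<sigma>s d) n)" for n S
    using that by (auto simp: sp carrier_homology tr_cls)
  moreover have "tr (homology_pmod F \<nu> \<sigma>s d) n' n'' (tr (homology_pmod F \<nu> \<sigma>s d) n n' S) =
      tr (homology_pmod F \<nu> \<sigma>s d) n n'' S"
    if "n \<le> n'" "n' \<le> n''" "S \<in> carrier (sp (homology_pmod F \<nu> \<sigma>s d) n)" for n n' n'' S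
    using that Z_mono[OF that(1), of d] by (auto simp: sp carrier_homology tr_cls subset_iff)
  ultimately show ?thesis
    by (simp add: persistence_module_def)
qed

section \<open>The bars and the isomorphism with a sum of interval modules\<close>

definition births :: "nat \<Rightarrow> nat list" where
  "births d = filter (\<lambda>k. sdim (\<sigma>s ! k) = d \<and> br k = None) [0..<length \<sigma>s]"

text \<open>Positions in the list start at 0, so the simplex at position \<open>k\<close> is present
  from stage \<open>k + 1\<close> on, and a partner \<open>j\<close> kills its class at stage
  \<open>j + 1\<close>. Without a partner the bar runs to the last stage.\<close>

definition lifetime :: "nat \<Rightarrow> nat set" where
  "lifetime k = {n. n \<le> length \<sigma>s \<and> k < n \<and> (\<forall>j < n. br j \<noteq> Some k)}"

abbreviation "bars d \<equiv> map lifetime (births d)"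

lemma birthsD: "k \<in> set (births d) \<Longrightarrow> k < length \<sigma>s \<and> sdim (\<sigma>s ! k) = d \<and> br k = None"
  by (simp add: births_def)

lemma distinct_births: "distinct (births d)"
  by (simp add: births_def)

lemma alive_iff:
  "n \<le> length \<sigma>s \<Longrightarrow> alive n k \<and> sdim (\<sigma>s ! k) = d \<longleftrightarrow> k \<in> set (births d) \<and> n \<in> lifetime k"
  by (auto simp: alive_def births_def lifetime_def)

lemma index_interval_lifetime:
  assumes "k < length \<sigma>s"
  shows "index_interval (length \<sigma>s) (lifetime k)"
proof -
  \<comment> \<open>A partner of \<open>k\<close> has a larger position, so every bar contains at
    least the stage at which its simplex enters.\<close>
  have "Suc k \<in> lifetime k"
    using assms br_less[of _ k] by (force simp: lifetime_def)
  then show ?thesis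
    by (auto simp: index_interval_def lifetime_def)
qed

lemma lifetime_paired:
  assumes "br j = Some i"
  shows "lifetime i = {i + 1..<j + 1}"
proof -
  have "(\<forall>l < n. br l \<noteq> Some i) \<longleftrightarrow> n \<le> j" for n
    using assms br_inj[OF assms] by (metis not_le)
  then show ?thesis
    using br_less[OF assms] by (auto simp: lifetime_def)
qed

text \<open>On a class, \<open>coords\<close> does not depend on the representative, as the living coordinates vanish on
  boundaries.\<close>

definition coords :: "nat \<Rightarrow> nat \<Rightarrow> ('v set \<Rightarrow> 'k) set \<Rightarrow> nat \<Rightarrow> 'k" where
  "coords d n S = (\<lambda>q\<in>{..<length (births d)}.
     if n \<in> lifetime (births d ! q) then a (births d ! q) (SOME z. z \<in> S) else \<zero>)"

lemma coords_cls:
  assumes n: "n \<le> length \<sigma>s" and z: "z \<in> Z n d"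
  shows "coords d n (cls n d z) = (\<lambda>q\<in>{..<length (births d)}.
     if n \<in> lifetime (births d ! q) then a (births d ! q) z else \<zero>)"
proof -
  have "a k (SOME y. y \<in> cls n d z) = a k z"
    if k: "k \<in> set (births d)" "n \<in> lifetime k" for k
  proof -
    have "(SOME y. y \<in> cls n d z) \<in> cls n d z"
      using someI[of "\<lambda>y. y \<in> cls n d z", OF self_in_cls[OF z]] .
    then obtain b where b: "b \<in> B n d" "(SOME y. y \<in> cls n d z) = (\<lambda>x. b x \<oplus> z x)"
      unfolding cls_eq by auto
    have b': "b \<in> C n d" "b \<in> bd ` C n (Suc d)"
      using b(1) B_sub_Z cycles_eq boundaries_eq by blast+
    have k': "k < length \<sigma>s"
      using birthsD k(1) by blast
    have "a k b = \<zero>"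
      using boundary_iff[OF n b'(1)] b'(2) k k' by (simp add: lifetime_def)
    then show ?thesis
      using b(2) functional_add[OF functional_a[OF k'] C_V[OF b'(1)] Z_V[OF z]] a_closed[OF k' Z_V[OF z]]
      by simp
  qed
  then show ?thesis
    unfolding coords_def by (intro restrict_ext) auto
qed

lemma coords_cls_nth:
  "\<lbrakk>n \<le> length \<sigma>s; z \<in> Z n d; q < length (births d)\<rbrakk> \<Longrightarrow>
    coords d n (cls n d z) q = (if n \<in> lifetime (births d ! q) then a (births d ! q) z else \<zero>)"
  by (simp add: coords_cls)

lemma nth_births: "q < length (births d) \<Longrightarrow> births d ! q < length \<sigma>s"
  using birthsD nth_mem by blast

lemma coords_in_carrier:
  assumes "n \<le> length \<sigma>s" "z \<in> Z n d"
  shows "coords d n (cls n d z) \<in> carrier (sp (interval_sum F (bars d)) n)"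
  unfolding carrier_interval_sum coords_cls[OF assms]
  using a_closed[OF nth_births Z_V[OF assms(2)]] by (simp add: restrict_PiE_iff)

text \<open>Two cycles with equal living coordinates differ by a cycle whose living coordinates
  vanish, and that is a boundary.\<close>

lemma coords_inj:
  assumes n: "n \<le> length \<sigma>s" and z: "z \<in> Z n d" "z' \<in> Z n d"
    and eq: "coords d n (cls n d z) = coords d n (cls n d z')"
  shows "cls n d z = cls n d z'"
proof -
  let ?y = "\<lambda>x. z x \<oplus> (\<ominus> \<one>) \<otimes> z' x"
  have y: "?y \<in> Z n d"
    using z by (intro Z_add Z_smult) auto
  have y': "?y \<in> C n d" "bd ?y = (\<lambda>x. \<zero>)"
    using y unfolding cycles_eq by auto
  have "a k ?y = \<zero>" if k: "alive n k" "sdim (\<sigma>s ! k) = d" for k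
  proof -
    have k': "k \<in> set (births d)" "n \<in> lifetime k"
      using alive_iff[OF n] k by blast+
    then obtain q where q: "q < length (births d)" "k = births d ! q"
      by (metis in_set_conv_nth)
    have len: "k < length \<sigma>s"
      using birthsD[OF k'(1)] by blast
    have "a k z = a k z'"
      using coords_cls_nth[OF n z(1) q(1)] coords_cls_nth[OF n z(2) q(1)] eq k'(2) q(2) by simp
    then show ?thesis
      using a_diff[OF len Z_V[OF z(1)] Z_V[OF z(2)]] a_closed[OF len Z_V[OF z(2)]]
      by (simp add: minus_eq r_neg)
  qed
  then have "?y \<in> bd ` C n (Suc d)"
    using cycle_boundary_iff[OF n y'] by blast
  then have yB: "?y \<in> B n d"
    by (simp add: boundaries_eq)
  have "z = (\<lambda>x. ?y x \<oplus> z' x)"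
    using fun_space_closed[OF Z_V[OF z(1)]] fun_space_closed[OF Z_V[OF z(2)]]
    by (simp add: l_minus a_assoc l_neg)
  then have "z \<in> cls n d z'"
    unfolding cls_eq by (intro CollectI bexI[OF _ yB])
  then show ?thesis
    using abelian_subgroup.a_repr_independence'[OF subspace_pair.abelian_subgroup_U[OF subspace_pair], of z n d z'] z(2)
    by (simp add: ZS_simps(1))
qed

lemma coords_surj:
  assumes n: "n \<le> length \<sigma>s" and y: "y \<in> carrier (sp (interval_sum F (bars d)) n)"
  shows "\<exists>z \<in> Z n d. coords d n (cls n d z) = y"
proof -
  have y': "y \<in> (\<Pi>\<^sub>E q \<in> {..<length (births d)}. if n \<in> lifetime (births d ! q) then carrier F else {\<zero>})"
  proof -
    have "carrier (sp (interval_sum F (bars d)) n) = (\<Pi>\<^sub>E q \<in> {..<length (births d)}.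
        if n \<in> lifetime (births d ! q) then carrier F else {\<zero>})"
      unfolding carrier_interval_sum length_map by (rule PiE_cong) simp
    then show ?thesis
      using y by (simp only:)
  qed
  \<comment> \<open>The definite description turns a simplex index back into its position among the
    births, which is unique because \<open>births d\<close> has no repetitions.\<close>
  define f where "f k = (if k \<in> set (births d) \<and> n \<in> lifetime k
    then y (THE q. q < length (births d) \<and> births d ! q = k) else \<zero>)" for k
  have the: "(THE q'. q' < length (births d) \<and> births d ! q' = births d ! q) = q"
    if "q < length (births d)" for q
    using that distinct_births[of d] by (auto simp: nth_eq_iff_index_eq)
  have f_nth: "f (births d ! q) = y q" if q: "q < length (births d)" for q
    using the[OF q] PiE_mem[OF y', of q] q by (simp add: f_def split: if_splits)
  have f: "f k \<in> carrier F" for k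
  proof (cases "k \<in> set (births d)")
    case True
    then obtain q where "q < length (births d)" "k = births d ! q"
      by (metis in_set_conv_nth)
    then show ?thesis
      using f_nth PiE_mem[OF y', of q] by (simp split: if_splits)
  qed (simp add: f_def)
  obtain z where z: "z \<in> C n d" "bd z = (\<lambda>x. \<zero>)"
    "\<And>k. \<lbrakk>alive n k; sdim (\<sigma>s ! k) = d\<rbrakk> \<Longrightarrow> a k z = f k"
    using cycle_surj[of n f d, OF n f] by blast
  have zZ: "z \<in> Z n d"
    using z by (simp add: cycles_eq)
  have "coords d n (cls n d z) = y"
  proof (rule extensionalityI)
    show "coords d n (cls n d z) \<in> extensional {..<length (births d)}"
      by (simp add: coords_def)
    show "y \<in> extensional {..<length (births d)}"
      using y' by (simp add: PiE_iff)
    fix q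
    assume "q \<in> {..<length (births d)}"
    then have q: "q < length (births d)"
      by simp
    show "coords d n (cls n d z) q = y q"
    proof (cases "n \<in> lifetime (births d ! q)")
      case True
      then have "a (births d ! q) z = y q"
        using z(3)[of "births d ! q"] alive_iff[OF n, of "births d ! q" d] q f_nth by simp
      then show ?thesis
        using True coords_cls_nth[OF n zZ q] by simp
    next
      case False
      then show ?thesis
        using coords_cls_nth[OF n zZ q] PiE_mem[OF y', of q] q by simp
    qed
  qed
  then show ?thesis
    using zZ by blast
qed

lemma coords_linear:
  assumes n: "n \<le> length \<sigma>s"
  shows "linear_map F (homology F \<nu> (filt \<sigma>s n) d) (sp (interval_sum F (bars d)) n) (coords d n)"
proof (rule linear_mapI[OF vectorspace_homology vectorspace_interval_sum[OF field_axioms]])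
  show "coords d n S \<in> carrier (sp (interval_sum F (bars d)) n)"
    if "S \<in> carrier (homology F \<nu> (filt \<sigma>s n) d)" for S
    using that coords_in_carrier[OF n] by (auto simp: carrier_homology)
  show "coords d n (S \<oplus>\<^bsub>homology F \<nu> (filt \<sigma>s n) d\<^esub> T) =
      coords d n S \<oplus>\<^bsub>sp (interval_sum F (bars d)) n\<^esub> coords d n T"
    if ST: "S \<in> carrier (homology F \<nu> (filt \<sigma>s n) d)" "T \<in> carrier (homology F \<nu> (filt \<sigma>s n) d)" for S T
  proof -
    obtain z z' where z: "z \<in> Z n d" "S = cls n d z" and z': "z' \<in> Z n d" "T = cls n d z'"
      using ST unfolding carrier_homology by blast
    show ?thesis
      unfolding z(2) z'(2) homology_add[OF z(1) z'(1)] add_interval_sum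
        coords_cls[OF n z(1)] coords_cls[OF n z'(1)] coords_cls[OF n Z_add[OF z(1) z'(1)]] length_map
      by (rule restrict_ext)
        (simp add: functional_add[OF functional_a[OF nth_births] Z_V[OF z(1)] Z_V[OF z'(1)]])
  qed
  show "coords d n (s \<odot>\<^bsub>homology F \<nu> (filt \<sigma>s n) d\<^esub> S) =
      s \<odot>\<^bsub>sp (interval_sum F (bars d)) n\<^esub> coords d n S"
    if sS: "s \<in> carrier F" "S \<in> carrier (homology F \<nu> (filt \<sigma>s n) d)" for s S
  proof -
    obtain z where z: "z \<in> Z n d" "S = cls n d z"
      using sS(2) unfolding carrier_homology by blast
    show ?thesis
      unfolding z(2) homology_smult[OF sS(1) z(1)] smult_interval_sum
        coords_cls[OF n z(1)] coords_cls[OF n Z_smult[OF sS(1) z(1)]] length_map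
      by (rule restrict_ext)
        (simp add: functional_smult[OF functional_a[OF nth_births] sS(1) Z_V[OF z(1)]] sS(1))
  qed
qed

text \<open>The one case to check is a bar containing \<open>n'\<close> but not the earlier
  \<open>n\<close>. It can only be one that starts after \<open>n\<close>, and its coordinate
  vanishes on chains of stage \<open>n\<close>, as the zero map of the interval module
  demands.\<close>

lemma coords_tr:
  assumes n: "n \<le> n'" "n' \<le> length \<sigma>s" and z: "z \<in> Z n d"
  shows "coords d n' (tr (homology_pmod F \<nu> \<sigma>s d) n n' (cls n d z)) =
    tr (interval_sum F (bars d)) n n' (coords d n (cls n d z))"
proof -
  have len: "n \<le> length \<sigma>s" and z': "z \<in> Z n' d" and zn: "z \<in> V_upto n"
    using n z Z_mono[OF n(1)] C_V_upto by (auto simp: cycles_eq)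
  have "a k z = \<zero>" if "k < length \<sigma>s" "n' \<in> lifetime k" "n \<notin> lifetime k" for k
    using that a_V_upto[OF zn] n by (force simp: lifetime_def)
  then show ?thesis
    unfolding tr_cls[OF n(1) z] coords_cls[OF n(2) z'] coords_cls[OF len z] tr_interval_sum length_map
    by (intro restrict_ext) (simp add: nth_births)
qed

lemma is_barcode_bars: "is_barcode F (length \<sigma>s) (homology_pmod F \<nu> \<sigma>s d) (mset (bars d))"
proof -
  have sp: "sp (homology_pmod F \<nu> \<sigma>s d) n = homology F \<nu> (filt \<sigma>s n) d" for n
    by (simp add: homology_pmod_def)
  have "bij_betw (coords d n) (carrier (homology F \<nu> (filt \<sigma>s n) d)) (carrier (sp (interval_sum F (bars d)) n))"
    if n: "n \<le> length \<sigma>s" for n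
    unfolding carrier_homology
  proof (rule bij_betw_imageI)
    show "inj_on (coords d n) (cls n d ` Z n d)"
      using coords_inj[OF n] by (intro inj_onI) blast
    show "coords d n ` cls n d ` Z n d = carrier (sp (interval_sum F (bars d)) n)"
      using coords_surj[OF n] coords_in_carrier[OF n] by (auto simp: image_iff) metis
  qed
  then have "pmod_iso F (length \<sigma>s) (homology_pmod F \<nu> \<sigma>s d) (interval_sum F (bars d))"
    unfolding pmod_iso_def sp using coords_linear coords_tr
    by (intro exI[of _ "coords d"]) (auto simp: carrier_homology)
  moreover have "\<forall>J \<in> set (bars d). index_interval (length \<sigma>s) J"
    using birthsD index_interval_lifetime by auto
  ultimately show ?thesis
    using persistence_module_homology unfolding is_barcode_def interval_sum_def by blast
qed

lemma paired_persistence_pair: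
  assumes F: "1 < card (carrier F)" and ij: "br j = Some i"
  shows "persistence_pair F \<nu> \<sigma>s (\<sigma>s ! i) (\<sigma>s ! j)"
proof -
  have less: "i < j" "j < length \<sigma>s"
    using br_less[OF ij] by auto
  let ?d = "sdim (\<sigma>s ! i)"
  have "i \<in> set (births ?d)"
    using birth_unpaired[OF ij] less by (simp add: births_def)
  then have "{i + 1..<j + 1} \<in> set (bars ?d)"
    using lifetime_paired[OF ij] by (metis image_eqI set_map)
  then have "{i + 1..<j + 1} \<in># barcode F (length \<sigma>s) (homology_pmod F \<nu> \<sigma>s ?d)"
    using barcode_eqI[OF zero_closed F is_barcode_bars] by simp
  \<comment> \<open>The shift by one converts list positions into the numbering from 1 used by
    \<open>persistence_pair\<close>.\<close>
  then show ?thesis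
    unfolding persistence_pair_def using less
    by (intro bexI[of _ "i + 1"] bexI[of _ "j + 1"] conjI exI[of _ ?d]) auto
qed

end

lemma (in filtered_oriented_complex) apparent_pair_persistence_pair:
  assumes F: "1 < card (carrier F)" and app: "apparent_pair \<sigma>s \<sigma> \<tau>"
  shows "persistence_pair F \<nu> \<sigma>s \<sigma> \<tau>"
proof -
  obtain a br where "reduction F \<sigma>s sdim (boundary F \<nu> K) (length \<sigma>s) a br"
    using reduction_exists by blast
  then interpret reduction F \<sigma>s sdim "boundary F \<nu> K" "length \<sigma>s" a br .
  interpret homology_reduction F K \<nu> \<sigma>s a br ..
  have facet: "facet K \<sigma> \<tau>"
    and youngest: "\<And>\<rho>. \<lbrakk>facet K \<rho> \<tau>; \<rho> \<noteq> \<sigma>\<rbrakk> \<Longrightarrow> older \<sigma>s \<rho> \<sigma>"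
    and oldest: "\<And>\<upsilon>. \<lbrakk>facet K \<sigma> \<upsilon>; \<upsilon> \<noteq> \<tau>\<rbrakk> \<Longrightarrow> older \<sigma>s \<tau> \<upsilon>"
    using app by (auto simp: apparent_pair_def youngest_facet_def oldest_cofacet_def set_order)
  obtain i j where ij: "i < j" "j < length \<sigma>s" "\<sigma> = \<sigma>s ! i" "\<tau> = \<sigma>s ! j"
    using facet by (rule facet_obtain_index)
  have older_nth: "k < l" if "older \<sigma>s (\<sigma>s ! k) (\<sigma>s ! l)" "k < length \<sigma>s" "l < length \<sigma>s" for k l
    using that distinct by (auto simp: older_def nth_eq_iff_index_eq)
  have "br j = Some i"
  proof (rule apparent_paired)
    show "i < length \<sigma>s" "j < length \<sigma>s"
      using ij by auto
    show "boundary F \<nu> K (unit_chain j) (\<sigma>s ! i) \<noteq> \<zero>"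
      using facet ij incidence_nonzero by (simp add: boundary_unit_chain)
    show "boundary F \<nu> K (unit_chain j) (\<sigma>s ! l) = \<zero>" if l: "i < l" "l < length \<sigma>s" for l
    proof -
      \<comment> \<open>Being the youngest facet puts all other facets of \<open>\<tau>\<close>
        before position \<open>i\<close>.\<close>
      have "\<not> facet K (\<sigma>s ! l) \<tau>"
        using youngest[of "\<sigma>s ! l"] older_nth[of l i] l ij distinct by (auto simp: nth_eq_iff_index_eq)
      then show ?thesis
        using ij by (simp add: boundary_unit_chain)
    qed
    show "boundary F \<nu> K z (\<sigma>s ! i) = \<zero>" if z: "z \<in> V_upto j" for z
    proof (rule boundary_zero)
      fix \<upsilon>
      assume \<upsilon>: "facet K (\<sigma>s ! i) \<upsilon>"
      then obtain l where l: "l < length \<sigma>s" "\<upsilon> = \<sigma>s ! l"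
        by (rule facet_obtain_index) blast
      \<comment> \<open>Being the oldest cofacet puts every cofacet of \<open>\<sigma>\<close> at
        position \<open>j\<close> or later, out of reach of a chain on the first \<open>j\<close>
        simplices.\<close>
      have "j \<le> l"
        using oldest[of \<upsilon>] \<upsilon> older_nth[of j l] l ij distinct by (cases "l = j") (auto simp: nth_eq_iff_index_eq)
      then show "z \<upsilon> = \<zero>"
        using V_upto_nth[OF z] l by simp
    qed
  qed
  then show ?thesis
    using paired_persistence_pair[OF F] ij by simp
qed

theorem lemma3p3:
  fixes K :: "'v set set" and \<sigma>s :: "'v set list" and \<sigma> \<tau> :: "'v set"
    and p :: nat and \<nu> :: "'v \<Rightarrow> nat"
  assumes "finite K" and "simplicial_cplx K"
    and "simplexwise_filtration K \<sigma>s"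
    and "prime p"
    and "inj_on \<nu> (\<Union>K)"
    and "apparent_pair \<sigma>s \<sigma> \<tau>"
  shows "persistence_pair (residue_ring (int p)) \<nu> \<sigma>s \<sigma> \<tau>"
proof -
  interpret residues_prime p "residue_ring (int p)"
    using assms(4) by unfold_locales auto
  interpret field "residue_ring (int p)"
    by (rule is_field)
  interpret filtered_oriented_complex "residue_ring (int p)" K \<nu> \<sigma>s
    using assms by unfold_locales
  have "1 < card (carrier (residue_ring (int p)))"
    using prime_gt_1_nat[OF assms(4)] by (simp add: residue_ring_def)
  then show ?thesis
    using assms(6) by (rule apparent_pair_persistence_pair)
qed

end
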